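(* Let $\{X_n\}_{n\in\mathbb Z}$ be a real-valued, doubly infinite, stationary and ergodic time series, and let the estimators $P_k$ ($k\ge 1$) and $\hat P_{-t}$ ($t\ge 1$) of the conditional distribution $P(\cdot\mid \mathbf X^-)$ of $X_0$ given the infinite past $\mathbf X^-=(X_{-1},X_{-2},\dots)$ be constructed as described in the context. Then $$\lim_{k\to\infty}P_k(\cdot)=P(\cdot\mid\mathbf X^-)\quad\text{a.s.}$$ and $$\lim_{t\to\infty}\hat P_{-t}(\cdot)=P(\cdot\mid\mathbf X^-)\quad\text{a.s.,}$$ both limits being in the weak topology of distributions (i.e. almost surely, the random probability measures $P_k$, respectively $\hat P_{-t}$, converge weakly to the conditional distribution $P(\cdot\mid\mathbf X^-)$).
   Context: Notation: for $i\le j$, $X_i^j=(X_i,X_{i+1},\dots,X_j)$. For a Borel set $C\subseteq\mathbb R$, $P(C\mid\mathbf X^-)=P(X_0\in C\mid X_{-\infty}^{-1})$; $P(\cdot\mid\mathbf X^-)$ denotes the (regular) conditional distribution of $X_0$ given $\mathbf X^-$. Partitions and quantizers: $\mathcal P_k=\{A_{k,i}: i=1,\dots,m_k\}$, $k\ge1$, is a sequence of finite partitions of the real line into (finite or infinite) right semi-closed intervals such that the finite $\sigma$-algebras $\sigma(\mathcal P_k)$ are increasing in $k$ and asymptotically generate the Borel $\sigma$-field (i.e. $\bigcup_k\sigma(\mathcal P_k)$ generates it). The quantizer $G_k$ is defined by $G_k(x)=A_{k,i}$ if $x\in A_{k,i}$, and it is applied to vectors coordinatewise. Recursive construction: put $\lambda_0=1$,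 and for $k=1,2,\dots$ let $$\tau_k=\min\{t>0:\ G_k(X_{-\lambda_{k-1}-t}^{-1-t})=G_k(X_{-\lambda_{k-1}}^{-1})\},\qquad \lambda_k=\tau_k+\lambda_{k-1}.$$ Here $t$ ranges over positive integers; by ergodicity all $\tau_k$ are a.s. finite. Estimators: for Borel $C$, $$P_k(C)=\frac1k\sum_{1\le j\le k}1_C(X_{-\tau_j}),$$ where $1_C$ is the indicator function of $C$. For an integer $t>0$, let $\kappa_t$ be the maximum of the integers $k$ for which $\lambda_k\le t$, and put $\hat P_{-t}(C)=P_{\kappa_t}(C)$ (a.s. $\kappa_t\ge1$ for all large $t$, so the value when $\kappa_t=0$ is irrelevant to the limit). *)

theory Defs
  imports "HOL-Probability.Probability"
begin

abbreviation path_space :: "(int \<Rightarrow> real) measure" where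
  "path_space \<equiv> PiM UNIV (\<lambda>_. borel)"

definition stationary_process :: "'a measure \<Rightarrow> (int \<Rightarrow> 'a \<Rightarrow> real) \<Rightarrow> bool" where
  "stationary_process M X \<longleftrightarrow>
     (\<forall>k. distr M path_space (\<lambda>\<omega> n. X (n + k) \<omega>) = distr M path_space (\<lambda>\<omega> n. X n \<omega>))"

definition ergodic_process :: "'a measure \<Rightarrow> (int \<Rightarrow> 'a \<Rightarrow> real) \<Rightarrow> bool" where
  "ergodic_process M X \<longleftrightarrow>
     (\<forall>A \<in> sets path_space. (\<lambda>x n. x (n + 1)) -` A = A \<longrightarrow>
        measure (distr M path_space (\<lambda>\<omega> n. X n \<omega>)) A \<in> {0, 1})"

definition past_algebra :: "'a measure \<Rightarrow> (int \<Rightarrow> 'a \<Rightarrow> real) \<Rightarrow> 'a measure" where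
  "past_algebra M X =
     vimage_algebra (space M) (\<lambda>\<omega>. \<lambda>n\<in>{..-1}. X n \<omega>) (PiM {..-1} (\<lambda>_. borel))"

definition regular_cond_distr ::
  "'a measure \<Rightarrow> 'a measure \<Rightarrow> ('a \<Rightarrow> real) \<Rightarrow> ('a \<Rightarrow> real measure) \<Rightarrow> bool" where
  "regular_cond_distr M F Y K \<longleftrightarrow>
     K \<in> F \<rightarrow>\<^sub>M prob_algebra borel \<and>
     (\<forall>C \<in> sets borel. AE \<omega> in M. measure (K \<omega>) C = real_cond_exp M F (\<lambda>\<omega>'. indicator C (Y \<omega>')) \<omega>)"

text \<open>Extended real end points cover all the intervals \<open>(a, b]\<close>, \<open>(-\<infinity>, b]\<close>,
  \<open>(a, \<infinity>)\<close> and the whole line.\<close>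

definition right_semiclosed_interval :: "real set \<Rightarrow> bool" where
  "right_semiclosed_interval A \<longleftrightarrow> (\<exists>a b :: ereal. A = {x. a < ereal x \<and> ereal x \<le> b})"

text \<open>Only the partitions with index \<open>k \<ge> 1\<close> matter; the value at \<open>0\<close> is unconstrained.\<close>

definition admissible_partitions :: "(nat \<Rightarrow> real set set) \<Rightarrow> bool" where
  "admissible_partitions \<P> \<longleftrightarrow>
     (\<forall>k\<ge>1. finite (\<P> k) \<and> partition_on UNIV (\<P> k) \<and> (\<forall>A\<in>\<P> k. right_semiclosed_interval A)) \<and>
     (\<forall>k\<ge>1. sigma_sets UNIV (\<P> k) \<subseteq> sigma_sets UNIV (\<P> (Suc k))) \<and>
     sigma_sets UNIV (\<Union>k\<in>{1..}. sigma_sets UNIV (\<P> k)) = sets borel"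

definition quantizer :: "(nat \<Rightarrow> real set set) \<Rightarrow> nat \<Rightarrow> real \<Rightarrow> real set" where
  "quantizer \<P> k x = (THE A. A \<in> \<P> k \<and> x \<in> A)"

definition block :: "(int \<Rightarrow> real) \<Rightarrow> int \<Rightarrow> int \<Rightarrow> real list" where
  "block x i j = map x [i..j]"

definition recurrence_time :: "(nat \<Rightarrow> real set set) \<Rightarrow> (int \<Rightarrow> real) \<Rightarrow> nat \<Rightarrow> nat \<Rightarrow> nat" where
  "recurrence_time \<P> x k l =
     (LEAST t. t > 0 \<and>
        map (quantizer \<P> k) (block x (- int l - int t) (- 1 - int t)) =
        map (quantizer \<P> k) (block x (- int l) (- 1)))"

primrec match_len :: "(nat \<Rightarrow> real set set) \<Rightarrow> (int \<Rightarrow> real) \<Rightarrow> nat \<Rightarrow> nat" where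
  "match_len \<P> x 0 = 1"
| "match_len \<P> x (Suc k) = recurrence_time \<P> x (Suc k) (match_len \<P> x k) + match_len \<P> x k"

text \<open>\<open>match_len\<close> and \<open>match_time\<close> are $\lambda_k$ and $\tau_k$. If no match exists at some stage
  then \<open>LEAST\<close> leaves the value unspecified; for a stationary ergodic process this happens only on a
  null set.\<close>

definition match_time :: "(nat \<Rightarrow> real set set) \<Rightarrow> (int \<Rightarrow> real) \<Rightarrow> nat \<Rightarrow> nat" where
  "match_time \<P> x k = recurrence_time \<P> x k (match_len \<P> x (k - 1))"

definition estimator :: "(nat \<Rightarrow> real set set) \<Rightarrow> (int \<Rightarrow> real) \<Rightarrow> nat \<Rightarrow> real measure" where
  "estimator \<P> x k =
     measure_of UNIV (sets borel)
       (\<lambda>C. ennreal (1 / real k * (\<Sum>j = 1..k. indicator C (x (- int (match_time \<P> x j))))))"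

lemma sets_estimator [simp, measurable_cong]: "sets (estimator \<P> x k) = sets borel"
  unfolding estimator_def using sets.sigma_sets_eq[of "borel :: real measure"] by simp

lemma space_estimator [simp]: "space (estimator \<P> x k) = UNIV"
  unfolding estimator_def by (simp add: space_measure_of_conv)

text \<open>The set function above is countably additive, so \<open>measure_of\<close> does not collapse to the null
  measure.\<close>

lemma emeasure_estimator:
  assumes C: "C \<in> sets borel"
  shows "emeasure (estimator \<P> x k) C =
    ennreal (1 / real k * (\<Sum>j = 1..k. indicator C (x (- int (match_time \<P> x j)))))"
proof (rule emeasure_measure_of[OF estimator_def])
  let ?y = "\<lambda>j. x (- int (match_time \<P> x j))"
  let ?f = "\<lambda>C. ennreal (1 / real k * (\<Sum>j = 1..k. indicator C (?y j)))"
  show "positive (sets (estimator \<P> x k)) ?f"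
    by (simp add: positive_def)
  show "countably_additive (sets (estimator \<P> x k)) ?f"
  proof (rule countably_additiveI)
    fix A :: "nat \<Rightarrow> real set"
    assume disj: "disjoint_family A"
    have rw: "?f B = ennreal (1 / real k) * (\<Sum>j = 1..k. indicator B (?y j))" for B
    proof -
      have "?f B = ennreal (1 / real k) * ennreal (\<Sum>j = 1..k. indicator B (?y j))"
        by (rule ennreal_mult) (auto intro: sum_nonneg)
      also have "ennreal (\<Sum>j = 1..k. indicator B (?y j)) = (\<Sum>j = 1..k. indicator B (?y j))"
        by (subst sum_ennreal[symmetric]) (auto simp: ennreal_indicator)
      finally show ?thesis .
    qed
    have "(\<Sum>i. ?f (A i)) = ennreal (1 / real k) * (\<Sum>j = 1..k. \<Sum>i. indicator (A i) (?y j))"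
      unfolding rw by (simp add: suminf_sum)
    also have "\<dots> = ?f (\<Union>i. A i)"
      unfolding rw by (simp add: suminf_indicator[OF disj])
    finally show "(\<Sum>i. ?f (A i)) = ?f (\<Union>i. A i)" .
  qed
qed (use C in auto)

lemma measure_estimator:
  assumes "C \<in> sets borel"
  shows "measure (estimator \<P> x k) C =
    1 / real k * (\<Sum>j = 1..k. indicator C (x (- int (match_time \<P> x j))))"
  unfolding measure_def emeasure_estimator[OF assms]
  by (simp add: sum_nonneg)

lemma real_distribution_estimator:
  assumes "k \<ge> 1"
  shows "real_distribution (estimator \<P> x k)"
  using assms
  by (intro real_distribution.intro real_distribution_axioms.intro prob_spaceI)
     (auto simp: emeasure_estimator)

definition match_count :: "(nat \<Rightarrow> real set set) \<Rightarrow> (int \<Rightarrow> real) \<Rightarrow> nat \<Rightarrow> nat" where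
  "match_count \<P> x t = Max {k. match_len \<P> x k \<le> t}"

definition past_estimator :: "(nat \<Rightarrow> real set set) \<Rightarrow> (int \<Rightarrow> real) \<Rightarrow> nat \<Rightarrow> real measure" where
  "past_estimator \<P> x t = estimator \<P> x (match_count \<P> x t)"

end

theory Submission
  imports Defs
begin

text \<open>The idea is that $X_{-\tau_{n+1}}$ is a fair copy of $X_0$ given the quantized block that it was
  matched with. Let $\mathcal H_n$ be the information in the block
  $G_{n+1}(X_{-\lambda_n}^{-1})$. Given that this block equals a fixed word \<open>b\<close>, going back to the
  match at time $-\tau_{n+1}$ is going back to the previous visit of the trajectory to the event
  ``the last block reads \<open>b\<close>''. In a stationary process the map that sends a visit to the previous one
  preserves the law restricted to this event (\<open>first_return_measure_preserving\<close>), so for every Borel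
  set \<open>C\<close> the events $X_{-\tau_{n+1}} \in C$ and $X_0 \in C$ have the same conditional probability
  $p_n$ given $\mathcal H_n$ (\<open>cond_exp_match_event\<close>). The same recurrence argument,
  Poincare's theorem, makes all match times finite almost surely (\<open>AE_recurrent\<close>).

  A word that is seen once more is found inside the longer block of the next stage, and the later
  quantizers refine the earlier ones. Hence $\mathcal H_n$ increases with \<open>n\<close>, and for \<open>C\<close> in some
  $\sigma(\mathcal P_k)$ the event $X_{-\tau_{n+1}} \in C$ belongs to $\mathcal H_{n+1}$ from
  some \<open>n\<close> on. So $1_C(X_{-\tau_{n+1}}) - p_n$ are bounded martingale differences; they are orthogonal,
  and their averages tend to \<open>0\<close> (\<open>averages_of_orthogonal_bounded_tendsto_0\<close>). On the other hand
  $p_n$ converges to the conditional probability of $X_0 \in C$ given the whole past by Levy's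
  theorem (\<open>levy_upward\<close>), since $\lambda_n \to \infty$ and the partitions generate the
  Borel sets (\<open>past_approximable\<close>); its Cesaro means have the same limit.

  This gives $P_k(C) \to P(C \mid \mathbf X^-)$ almost surely, simultaneously for the countably many
  finite unions \<open>C\<close> of cells. Among these unions there are half-lines whose end points are dense
  (\<open>half_lines_dense\<close>), and convergence of distribution functions at a dense set of points is weak
  convergence. The second claim follows from the first since $\kappa_t \to \infty$.\<close>

section \<open>Averages of bounded orthogonal random variables\<close>

lemma cesaro_mean_tendsto:
  fixes c :: "nat \<Rightarrow> real"
  assumes "c \<longlonglongrightarrow> L"
  shows "(\<lambda>n. (\<Sum>i<n. c i) / real n) \<longlonglongrightarrow> L"
proof -
  have "(\<lambda>n. (\<Sum>i<n. c i - L) / real n) \<longlonglongrightarrow> 0"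
  proof (rule LIMSEQ_I)
    fix e :: real assume e: "e > 0"
    obtain N where N: "\<And>n. n \<ge> N \<Longrightarrow> \<bar>c n - L\<bar> < e / 2"
      using LIMSEQ_D[OF assms, of "e / 2"] e by auto
    define B where "B = (\<Sum>i<N. \<bar>c i - L\<bar>)"
    obtain m :: nat where m: "2 * B / e < real m" using reals_Archimedean2 by blast
    have "norm ((\<Sum>i<n. c i - L) / real n - 0) < e" if "n \<ge> max (Suc N) m" for n
    proof -
      have n: "n > 0" "N \<le> n" "2 * B < e * real n"
        using that m e by (auto simp: field_simps) (smt (verit) mult_left_mono of_nat_le_iff)
      have "\<bar>\<Sum>i<n. c i - L\<bar> \<le> (\<Sum>i<n. \<bar>c i - L\<bar>)" by (rule sum_abs)
      also have "\<dots> = B + (\<Sum>i=N..<n. \<bar>c i - L\<bar>)"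
        using n(2) unfolding B_def by (metis atLeast0LessThan le0 sum.atLeastLessThan_concat)
      also have "(\<Sum>i=N..<n. \<bar>c i - L\<bar>) \<le> (\<Sum>i=N..<n. e / 2)"
        by (intro sum_mono) (use N in \<open>auto intro: less_imp_le\<close>)
      also have "\<dots> \<le> real n * (e / 2)" using e by (simp add: mult_right_mono)
      finally have "\<bar>\<Sum>i<n. c i - L\<bar> < e * real n" using n(3) by (simp add: mult.commute)
      then show ?thesis using n(1) by (simp add: abs_divide field_simps)
    qed
    then show "\<exists>no. \<forall>n\<ge>no. norm ((\<Sum>i<n. c i - L) / real n - 0) < e" by blast
  qed
  then have "(\<lambda>n. (\<Sum>i<n. c i - L) / real n + L) \<longlonglongrightarrow> 0 + L"
    by (intro tendsto_intros)
  moreover have "eventually (\<lambda>n. (\<Sum>i<n. c i - L) / real n + L = (\<Sum>i<n. c i) / real n) sequentially"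
    using eventually_gt_at_top[of 0]
    by eventually_elim (simp add: sum_subtractf field_simps)
  ultimately show ?thesis using Lim_transform_eventually by fastforce
qed

text \<open>Between two consecutive squares a sum of terms bounded by \<open>1\<close> changes by at most $2n$, which is
  negligible against $n^2$. This gap filling is what makes second moments sufficient: along the squares
  the Chebyshev bounds $1/n^2$ are summable.\<close>

lemma averages_tendsto_0_if_square_averages_tendsto_0:
  fixes a :: "nat \<Rightarrow> real"
  assumes bound: "\<And>i. \<bar>a i\<bar> \<le> 1"
    and squares: "(\<lambda>n. (\<Sum>i<n\<^sup>2. a i) / real (n\<^sup>2)) \<longlonglongrightarrow> 0"
  shows "(\<lambda>n. (\<Sum>i<n. a i) / real n) \<longlonglongrightarrow> 0"
proof (rule LIMSEQ_I)
  fix e :: real assume "e > 0"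
  define b where "b n = (\<Sum>i<n\<^sup>2. a i) / real (n\<^sup>2)" for n
  obtain N1 where N1: "\<And>n. n \<ge> N1 \<Longrightarrow> \<bar>b n\<bar> < e / 2"
    using LIMSEQ_D[OF squares, of "e / 2"] \<open>e > 0\<close> by (auto simp: b_def)
  obtain N2 :: nat where N2: "4 / e < real N2"
    using reals_Archimedean2 by blast
  define N where "N = max 1 (max N1 N2)"
  have "norm ((\<Sum>i<k. a i) / real k - 0) < e" if "k \<ge> N\<^sup>2" for k
  proof -
    define n where "n = nat \<lfloor>sqrt (real k)\<rfloor>"
    have n_sqrt: "real n \<le> sqrt (real k)" "sqrt (real k) < real n + 1"
      unfolding n_def by (simp_all add: of_nat_nat)
    have n_le: "n\<^sup>2 \<le> k"
      by (metis n_sqrt(1) of_nat_0_le_iff of_nat_le_iff of_nat_power real_sqrt_le_iff real_sqrt_unique)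
    have "real k < (real n + 1)\<^sup>2"
      using n_sqrt(2) by (metis add_nonneg_nonneg of_nat_0_le_iff real_sqrt_less_iff real_sqrt_unique zero_le_one)
    then have k_less: "k < (n + 1)\<^sup>2"
      by (metis of_nat_1 of_nat_add of_nat_less_iff of_nat_power)
    have "N < n + 1"
      using that k_less by (meson le_less_trans power_less_imp_less_base zero_le)
    then have "n \<ge> N" by simp
    then have n: "n \<ge> 1" "\<bar>b n\<bar> < e / 2" "4 / e < real n"
      using N1[of n] N2 by (auto simp: N_def)
    have "(\<Sum>i<k. a i) = (\<Sum>i<n\<^sup>2. a i) + (\<Sum>i=n\<^sup>2..<k. a i)"
      using n_le by (metis atLeast0LessThan le0 sum.atLeastLessThan_concat)
    moreover have "\<bar>\<Sum>i=n\<^sup>2..<k. a i\<bar> \<le> 2 * real n"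
    proof -
      have "\<bar>\<Sum>i=n\<^sup>2..<k. a i\<bar> \<le> (\<Sum>i=n\<^sup>2..<k. 1)"
        by (rule order_trans[OF sum_abs]) (intro sum_mono bound)
      also have "\<dots> = real (k - n\<^sup>2)" by simp
      also have "k - n\<^sup>2 \<le> 2 * n" using k_less by (simp add: power2_eq_square)
      then have "real (k - n\<^sup>2) \<le> 2 * real n"
        by (metis of_nat_le_iff of_nat_mult of_nat_numeral)
      finally show ?thesis .
    qed
    ultimately have "\<bar>\<Sum>i<k. a i\<bar> \<le> \<bar>\<Sum>i<n\<^sup>2. a i\<bar> + 2 * real n" by linarith
    then have "\<bar>\<Sum>i<k. a i\<bar> / real k \<le> (\<bar>\<Sum>i<n\<^sup>2. a i\<bar> + 2 * real n) / real k"
      by (rule divide_right_mono) simp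
    also have "\<dots> \<le> (\<bar>\<Sum>i<n\<^sup>2. a i\<bar> + 2 * real n) / real (n\<^sup>2)"
    proof (rule divide_left_mono)
      show "real (n\<^sup>2) \<le> real k" using n_le by (simp only: of_nat_le_iff)
      show "0 < real k * real (n\<^sup>2)" using n(1) n_le
        by (metis le_less_trans less_le_trans mult_pos_pos of_nat_0_less_iff pos2 zero_less_power less_le_trans zero_less_one)
    qed simp
    also have "\<dots> = \<bar>b n\<bar> + 2 / real n"
      using n(1) by (simp add: b_def abs_divide add_divide_distrib power2_eq_square)
    also have "\<dots> < e"
    proof -
      have "2 / real n < e / 2" using n(1,3) \<open>e > 0\<close> by (simp add: field_simps)
      then show ?thesis using n(2) by linarith
    qed
    finally show ?thesis by simp
  qed
  then show "\<exists>no. \<forall>n\<ge>no. norm ((\<Sum>i<n. a i) / real n - 0) < e" by blast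
qed

text \<open>The sum of \<open>n\<close> orthogonal variables bounded by \<open>1\<close> has second moment at most \<open>n\<close>, so the squared
  averages along $n^2$ have expectations at most $1/n^2$. Their sum has finite expectation, hence
  is almost surely finite, and its terms tend to \<open>0\<close>.\<close>

lemma (in prob_space) averages_of_orthogonal_bounded_tendsto_0:
  fixes d :: "nat \<Rightarrow> 'a \<Rightarrow> real"
  assumes meas [measurable]: "\<And>i. d i \<in> borel_measurable M"
    and bound: "\<And>i. AE x in M. \<bar>d i x\<bar> \<le> 1"
    and orth: "\<And>i j. i < j \<Longrightarrow> expectation (\<lambda>x. d i x * d j x) = 0"
  shows "AE x in M. (\<lambda>n. (\<Sum>i<n. d i x) / real n) \<longlonglongrightarrow> 0"
proof -
  have prod_bound: "AE x in M. \<bar>d i x * d j x\<bar> \<le> 1" for i j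
    using bound[of i] bound[of j] by eventually_elim (simp add: abs_mult mult_le_one)
  have int: "integrable M (\<lambda>x. d i x * d j x)" for i j
    by (rule integrable_const_bound[where B=1]) (use prod_bound[of i j] in simp_all)
  have off_diag: "expectation (\<lambda>x. d i x * d j x) = 0" if "i \<noteq> j" for i j
    using that orth[of i j] orth[of j i] by (cases i j rule: linorder_cases) (simp_all add: mult.commute)
  have diag: "expectation (\<lambda>x. d i x * d i x) \<le> 1" for i
    by (rule integral_le_const[OF int]) (use prod_bound[of i i] in \<open>auto elim: eventually_mono\<close>)
  have second_moment: "expectation (\<lambda>x. (\<Sum>i<n. d i x)\<^sup>2) \<le> real n"
    and second_moment_int: "integrable M (\<lambda>x. (\<Sum>i<n. d i x)\<^sup>2)" for n
  proof -
    show "integrable M (\<lambda>x. (\<Sum>i<n. d i x)\<^sup>2)"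
      unfolding power2_eq_square sum_product by (intro Bochner_Integration.integrable_sum int)
    have "expectation (\<lambda>x. (\<Sum>i<n. d i x)\<^sup>2) = (\<Sum>i<n. \<Sum>j<n. expectation (\<lambda>x. d i x * d j x))"
      unfolding power2_eq_square sum_product
      by (simp add: Bochner_Integration.integral_sum int)
    also have "\<dots> = (\<Sum>i<n. \<Sum>j<n. if i = j then expectation (\<lambda>x. d i x * d i x) else 0)"
      by (intro sum.cong refl) (simp add: off_diag)
    also have "\<dots> = (\<Sum>i<n. expectation (\<lambda>x. d i x * d i x))" by simp
    also have "\<dots> \<le> (\<Sum>i<n. 1)" by (intro sum_mono diag)
    finally show "expectation (\<lambda>x. (\<Sum>i<n. d i x)\<^sup>2) \<le> real n" by simp
  qed
  define q where "q n x = ((\<Sum>i<n\<^sup>2. d i x) / real (n\<^sup>2))\<^sup>2" for n x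
  have [measurable]: "q n \<in> borel_measurable M" for n unfolding q_def by measurable
  have q_int: "(\<integral>\<^sup>+x. ennreal (q n x) \<partial>M) \<le> ennreal (1 / (real n)\<^sup>2)" for n
  proof -
    have "integrable M (q n)"
      unfolding q_def power_divide by (intro integrable_divide_zero second_moment_int)
    moreover have "q n x \<ge> 0" for x by (simp add: q_def)
    ultimately have "(\<integral>\<^sup>+x. ennreal (q n x) \<partial>M) = ennreal (expectation (q n))"
      by (intro nn_integral_eq_integral) simp_all
    also have "expectation (q n) \<le> 1 / (real n)\<^sup>2"
    proof (cases "n = 0")
      case False
      have "expectation (q n) = expectation (\<lambda>x. (\<Sum>i<n\<^sup>2. d i x)\<^sup>2) / (real (n\<^sup>2))\<^sup>2"
        unfolding q_def power_divide by simp
      also have "\<dots> \<le> real (n\<^sup>2) / (real (n\<^sup>2))\<^sup>2"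
        by (intro divide_right_mono second_moment) simp
      also have "\<dots> = 1 / (real n)\<^sup>2" using False by (simp add: power2_eq_square)
      finally show ?thesis .
    next
      case True
      then have "q n = (\<lambda>x. 0)" by (simp add: q_def fun_eq_iff)
      with True show ?thesis by simp
    qed
    then have "ennreal (expectation (q n)) \<le> ennreal (1 / (real n)\<^sup>2)" by (rule ennreal_leI)
    finally show ?thesis .
  qed
  have "(\<integral>\<^sup>+x. (\<Sum>n. ennreal (q n x)) \<partial>M) = (\<Sum>n. \<integral>\<^sup>+x. ennreal (q n x) \<partial>M)"
    by (intro nn_integral_suminf) measurable
  also have "\<dots> \<le> (\<Sum>n. ennreal (1 / (real n)\<^sup>2))"
    by (intro suminf_le q_int summableI)
  also have "\<dots> < \<infinity>"
  proof -
    have "summable (\<lambda>n. 1 / (real n)\<^sup>2)"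
      using inverse_power_summable[of 2, where 'a=real] by (simp add: inverse_eq_divide)
    then have "(\<Sum>n. ennreal (1 / (real n)\<^sup>2)) = ennreal (\<Sum>n. 1 / (real n)\<^sup>2)"
      by (intro suminf_ennreal2) auto
    then show ?thesis by simp
  qed
  finally have "AE x in M. (\<Sum>n. ennreal (q n x)) \<noteq> \<infinity>"
    by (intro nn_integral_noteq_infinite) auto
  moreover have "AE x in M. \<forall>i. \<bar>d i x\<bar> \<le> 1"
    unfolding AE_all_countable using bound by blast
  ultimately show ?thesis
  proof eventually_elim
    case (elim x)
    have "summable (\<lambda>n. q n x)"
      using elim(1) by (intro summable_suminf_not_top) (auto simp: q_def)
    then have "(\<lambda>n. q n x) \<longlonglongrightarrow> 0" by (rule summable_LIMSEQ_zero)
    then have "(\<lambda>n. sqrt (q n x)) \<longlonglongrightarrow> 0"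
      using tendsto_real_sqrt[of "\<lambda>n. q n x" 0] by simp
    then have "(\<lambda>n. (\<Sum>i<n\<^sup>2. d i x) / real (n\<^sup>2)) \<longlonglongrightarrow> 0"
      unfolding q_def real_sqrt_abs by (simp only: tendsto_rabs_zero_iff)
    with elim(2) show ?case
      using averages_tendsto_0_if_square_averages_tendsto_0[of "\<lambda>i. d i x"] by blast
  qed
qed

section \<open>Levy's upward convergence theorem\<close>

locale filtered_prob_space = prob_space +
  fixes H :: "nat \<Rightarrow> 'a measure"
  assumes subalg: "\<And>n. subalgebra M (H n)"
    and subalg_Suc: "\<And>n. subalgebra (H (Suc n)) (H n)"
begin

lemma subalg_mono: "m \<le> n \<Longrightarrow> subalgebra (H n) (H m)"
proof (induction n rule: dec_induct)
  case base show ?case by (simp add: subalgebra_def)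
next
  case (step n) then show ?case using subalg_Suc[of n] by (auto simp: subalgebra_def)
qed

lemma sigma_finite_subalg: "sigma_finite_subalgebra M (H n)"
  by (intro finite_measure_subalgebra_is_sigma_finite finite_measure_subalgebra.intro
      finite_measure_axioms finite_measure_subalgebra_axioms.intro subalg)

lemma filtered_prob_space_shift: "filtered_prob_space M (\<lambda>n. H (m + n))"
  by unfold_locales (use subalg subalg_Suc in auto)

text \<open>Doob's maximal inequality for the martingale $E[W \mid H_n]$. On the event that \<open>n\<close> is the
  first index at which the martingale exceeds \<open>e\<close>, which lies in \<open>H n\<close>, the integrals of $W$ and of
  $E[W \mid H_n]$ agree; these events are disjoint, so their total contribution is at most $E[W]$.\<close>

lemma cond_exp_maximal_inequality:
  assumes W [measurable]: "integrable M W" and pos: "AE x in M. W x \<ge> 0" and "e > 0"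
  shows "prob {x \<in> space M. \<exists>n. real_cond_exp M (H n) W x > e} \<le> expectation W / e"
proof -
  define N where "N n = {x \<in> space M. real_cond_exp M (H n) W x > e}" for n
  have N_meas: "N m \<in> sets (H n)" if "m \<le> n" for m n
  proof -
    have "N m = {x \<in> space (H m). real_cond_exp M (H m) W x > e}"
      using subalg[of m] by (simp add: N_def subalgebra_def)
    also have "\<dots> \<in> sets (H m)" by measurable
    finally show ?thesis using subalg_mono[OF that] by (auto simp: subalgebra_def)
  qed
  \<comment> \<open>The disjointed sets record the first index at which the level is exceeded.\<close>
  have first_meas: "disjointed N n \<in> sets (H n)" for n
    unfolding disjointed_def by (intro sets.Diff sets.finite_UN N_meas) auto
  then have first_meas_M [measurable]: "disjointed N n \<in> sets M" for n
    using subalg[of n] by (auto simp: subalgebra_def)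
  have W_int: "integrable M (\<lambda>x. indicator (disjointed N n) x * W x)" for n
    using integrable_mult_indicator[OF first_meas_M W] by simp
  have first_bound: "e * prob (disjointed N n) \<le> expectation (\<lambda>x. indicator (disjointed N n) x * W x)" for n
  proof -
    interpret sigma_finite_subalgebra M "H n" by (rule sigma_finite_subalg)
    have "e * prob (disjointed N n) = expectation (\<lambda>x. indicator (disjointed N n) x * e)"
      by simp
    also have "\<dots> \<le> expectation (\<lambda>x. indicator (disjointed N n) x * real_cond_exp M (H n) W x)"
    proof (rule integral_mono)
      show "integrable M (\<lambda>x. indicator (disjointed N n) x * real_cond_exp M (H n) W x)"
        by (rule real_cond_exp_intg(1)[OF W_int]) (use first_meas W in auto)
      show "indicator (disjointed N n) x * e \<le> indicator (disjointed N n) x * real_cond_exp M (H n) W x" for x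
        using disjointed_subset[of N n] by (auto simp: indicator_def N_def)
      show "integrable M (\<lambda>x. indicator (disjointed N n) x * e)"
        by (intro integrable_mult_left integrable_real_indicator) (auto simp: emeasure_eq_measure)
    qed
    also have "\<dots> = expectation (\<lambda>x. indicator (disjointed N n) x * W x)"
      by (rule real_cond_exp_intg(2)[OF W_int]) (use first_meas W in auto)
    finally show ?thesis .
  qed
  have partial: "(\<Sum>i<n. prob (disjointed N i)) \<le> expectation W / e" for n
  proof -
    have "e * (\<Sum>i<n. prob (disjointed N i)) \<le> (\<Sum>i<n. expectation (\<lambda>x. indicator (disjointed N i) x * W x))"
      unfolding sum_distrib_left by (intro sum_mono first_bound)
    also have "\<dots> = expectation (\<lambda>x. \<Sum>i<n. indicator (disjointed N i) x * W x)"
      by (rule Bochner_Integration.integral_sum[symmetric]) (rule W_int)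
    also have "\<dots> \<le> expectation W"
    proof (rule integral_mono_AE)
      show "AE x in M. (\<Sum>i<n. indicator (disjointed N i) x * W x) \<le> W x"
        using pos
      proof eventually_elim
        case (elim x)
        have "(\<Sum>i<n. indicator (disjointed N i) x :: real) = indicator (\<Union>i<n. disjointed N i) x"
          by (rule indicator_UN_disjoint[symmetric])
            (simp_all add: disjoint_family_on_mono[OF subset_UNIV disjoint_family_disjointed])
        also have "\<dots> \<le> 1" by (simp add: indicator_def)
        finally have "(\<Sum>i<n. indicator (disjointed N i) x) * W x \<le> 1 * W x"
          by (rule mult_right_mono) (use elim in simp)
        then show ?case unfolding sum_distrib_right by simp
      qed
    qed (intro Bochner_Integration.integrable_sum W_int W)+
    finally show ?thesis using \<open>e > 0\<close> by (simp add: field_simps)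
  qed
  have "(\<lambda>n. prob (disjointed N n)) sums prob (\<Union>n. disjointed N n)"
    by (rule finite_measure_UNION) (auto simp: disjoint_family_disjointed)
  then have "prob (\<Union>n. disjointed N n) \<le> expectation W / e"
    unfolding sums_def by (rule LIMSEQ_le_const2) (use partial in auto)
  then show ?thesis
    unfolding UN_disjointed_eq by (simp add: N_def UNION_eq)
qed

text \<open>The completion, in the pseudometric of symmetric differences, of the algebra of events that
  occur in the filtration. Each of its members agrees up to a null set with an event of the
  \<open>\<sigma>\<close>-algebra that the filtration generates.\<close>

definition approximable_events :: "'a set set" where
  "approximable_events =
    {A \<in> events. \<forall>e>0. \<exists>n. \<exists>B\<in>sets (H n). prob ((A - B) \<union> (B - A)) < e}"

lemma approximable_events_Un:
  assumes A: "A1 \<in> approximable_events" "A2 \<in> approximable_events"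
  shows "A1 \<union> A2 \<in> approximable_events"
  unfolding approximable_events_def
proof (intro CollectI conjI allI impI)
  have [measurable]: "A1 \<in> events" "A2 \<in> events" using A by (auto simp: approximable_events_def)
  then show "A1 \<union> A2 \<in> events" by simp
  fix e :: real assume "e > 0"
  then have "e / 2 > 0" by simp
  then obtain n1 B1 n2 B2 where B: "B1 \<in> sets (H n1)" "prob ((A1 - B1) \<union> (B1 - A1)) < e / 2"
    "B2 \<in> sets (H n2)" "prob ((A2 - B2) \<union> (B2 - A2)) < e / 2"
    using A unfolding approximable_events_def by blast
  have [measurable]: "B1 \<in> events" "B2 \<in> events"
    using B(1,3) subalg by (auto simp: subalgebra_def)
  have "B1 \<in> sets (H (max n1 n2))" "B2 \<in> sets (H (max n1 n2))"
    using B(1,3) subalg_mono[of n1 "max n1 n2"] subalg_mono[of n2 "max n1 n2"] by (auto simp: subalgebra_def)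
  then have union: "B1 \<union> B2 \<in> sets (H (max n1 n2))" by simp
  have "prob (((A1 \<union> A2) - (B1 \<union> B2)) \<union> ((B1 \<union> B2) - (A1 \<union> A2)))
      \<le> prob (((A1 - B1) \<union> (B1 - A1)) \<union> ((A2 - B2) \<union> (B2 - A2)))"
    by (rule finite_measure_mono) auto
  also have "\<dots> \<le> prob ((A1 - B1) \<union> (B1 - A1)) + prob ((A2 - B2) \<union> (B2 - A2))"
    by (rule measure_Un_le) auto
  also have "\<dots> < e" using B(2,4) by simp
  finally have "prob (((A1 \<union> A2) - (B1 \<union> B2)) \<union> ((B1 \<union> B2) - (A1 \<union> A2))) < e" .
  with union show "\<exists>n. \<exists>B\<in>sets (H n). prob (((A1 \<union> A2) - B) \<union> (B - (A1 \<union> A2))) < e"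
    by blast
qed

lemma approximable_events_approx:
  assumes A: "A \<in> events" and near: "\<And>e. e > 0 \<Longrightarrow> \<exists>A'\<in>approximable_events. prob ((A - A') \<union> (A' - A)) < e"
  shows "A \<in> approximable_events"
  unfolding approximable_events_def
proof (intro CollectI conjI allI impI A)
  fix e :: real assume "e > 0"
  then have "e / 2 > 0" by simp
  then obtain A' where A': "A' \<in> approximable_events" "prob ((A - A') \<union> (A' - A)) < e / 2"
    using near by blast
  then obtain n B where B: "B \<in> sets (H n)" "prob ((A' - B) \<union> (B - A')) < e / 2"
    using \<open>e / 2 > 0\<close> unfolding approximable_events_def by blast
  have [measurable]: "A' \<in> events" "B \<in> events"
    using A'(1) B(1) subalg by (auto simp: approximable_events_def subalgebra_def)
  have "prob ((A - B) \<union> (B - A)) \<le> prob (((A - A') \<union> (A' - A)) \<union> ((A' - B) \<union> (B - A')))"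
    by (rule finite_measure_mono) (use A in auto)
  also have "\<dots> \<le> prob ((A - A') \<union> (A' - A)) + prob ((A' - B) \<union> (B - A'))"
    by (rule measure_Un_le) (use A in auto)
  also have "\<dots> < e" using A'(2) B(2) by simp
  finally show "\<exists>n. \<exists>B\<in>sets (H n). prob ((A - B) \<union> (B - A)) < e" using B(1) by blast
qed

lemma sigma_algebra_approximable_events: "sigma_algebra (space M) approximable_events"
  unfolding sigma_algebra_iff2
proof (intro conjI ballI allI impI)
  show "approximable_events \<subseteq> Pow (space M)"
    using sets.sets_into_space by (auto simp: approximable_events_def)
  show empty: "{} \<in> approximable_events"
    by (auto simp: approximable_events_def intro!: exI[of _ 0] bexI[of _ "{}"])
  fix A assume A: "A \<in> approximable_events"
  have "\<exists>n. \<exists>B\<in>sets (H n). prob ((space M - A - B) \<union> (B - (space M - A))) < e" if "e > 0" for e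
  proof -
    obtain n B where B: "B \<in> sets (H n)" "prob ((A - B) \<union> (B - A)) < e"
      using A \<open>e > 0\<close> unfolding approximable_events_def by blast
    have "space (H n) = space M" using subalg[of n] by (simp add: subalgebra_def)
    then have "space M - B \<in> sets (H n)" using sets.compl_sets[OF B(1)] by simp
    moreover have "A \<subseteq> space M" "B \<subseteq> space M"
      using A sets.sets_into_space[OF B(1)] sets.sets_into_space[of A M] \<open>space (H n) = space M\<close>
      by (auto simp: approximable_events_def)
    then have "(space M - A - (space M - B)) \<union> (space M - B - (space M - A)) = (A - B) \<union> (B - A)" by blast
    ultimately show ?thesis using B(2) by metis
  qed
  then show "space M - A \<in> approximable_events"
    using A by (auto simp: approximable_events_def)
next
  fix A :: "nat \<Rightarrow> 'a set" assume A: "range A \<subseteq> approximable_events"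
  then have [measurable]: "A i \<in> events" for i by (auto simp: approximable_events_def)
  have partial: "(\<Union>i<n. A i) \<in> approximable_events" for n
  proof (induction n)
    case 0
    show ?case by (auto simp: approximable_events_def intro!: exI[of _ 0] bexI[of _ "{}"])
  next
    case (Suc n)
    then show ?case using A approximable_events_Un[of "A n" "\<Union>i<n. A i"] by (auto simp: lessThan_Suc)
  qed
  have "incseq (\<lambda>n. \<Union>i<n. A i)" by (intro monoI UN_mono) auto
  then have "(\<lambda>n. prob (\<Union>i<n. A i)) \<longlonglongrightarrow> prob (\<Union>n. \<Union>i<n. A i)"
    by (intro finite_Lim_measure_incseq) auto
  moreover have "(\<Union>n. \<Union>i<n. A i) = (\<Union>i. A i)" by auto
  ultimately have lim: "(\<lambda>n. prob (\<Union>i<n. A i)) \<longlonglongrightarrow> prob (\<Union>i. A i)" by simp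
  show "(\<Union>i. A i) \<in> approximable_events"
  proof (rule approximable_events_approx)
    fix e :: real assume "e > 0"
    then obtain n where n: "\<bar>prob (\<Union>i<n. A i) - prob (\<Union>i. A i)\<bar> < e"
      using LIMSEQ_D[OF lim, of e] by auto
    have "(\<Union>i. A i) - (\<Union>i<n. A i) \<union> ((\<Union>i<n. A i) - (\<Union>i. A i)) = (\<Union>i. A i) - (\<Union>i<n. A i)" by auto
    moreover have "prob ((\<Union>i. A i) - (\<Union>i<n. A i)) = prob (\<Union>i. A i) - prob (\<Union>i<n. A i)"
      by (rule finite_measure_Diff) auto
    ultimately have "prob ((\<Union>i. A i) - (\<Union>i<n. A i) \<union> ((\<Union>i<n. A i) - (\<Union>i. A i))) < e"
      using n by simp
    then show "\<exists>A'\<in>approximable_events. prob ((\<Union>i. A i) - A' \<union> (A' - (\<Union>i. A i))) < e"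
      using partial by blast
  qed simp
qed

text \<open>The passage from events to functions: the variables that are $L^1$ limits of variables
  measurable at a finite stage are closed under sums and dominated limits.\<close>

lemma integrable_approximation:
  assumes F: "subalgebra M F" and dense: "sets F \<subseteq> approximable_events"
    and Z: "integrable M Z" "Z \<in> borel_measurable F" and "e > 0"
  shows "\<exists>n g. g \<in> borel_measurable (H n) \<and> integrable M g \<and> expectation (\<lambda>x. \<bar>Z x - g x\<bar>) < (e::real)"
proof -
  have "integrable (restr_to_subalg M F) Z"
    using integrable_in_subalg[OF F] Z by blast
  then have "\<forall>e>0. \<exists>n g. g \<in> borel_measurable (H n) \<and> integrable M g \<and> expectation (\<lambda>x. \<bar>Z x - g x\<bar>) < (e::real)"
    (is "?P Z")
  proof (induction Z)
    case (base A c)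
    have A: "A \<in> sets F" using base(1) sets_restr_to_subalg[OF F] by auto
    then have [measurable]: "A \<in> sets M" using F by (auto simp: subalgebra_def)
    show ?case
    proof (intro allI impI)
      fix e :: real assume "e > 0"
      then have "e / (\<bar>c\<bar> + 1) > 0" by simp
      then obtain n B where B: "B \<in> sets (H n)" "prob ((A - B) \<union> (B - A)) < e / (\<bar>c\<bar> + 1)"
        using dense A unfolding approximable_events_def by blast
      have [measurable]: "B \<in> sets M" using B(1) subalg[of n] by (auto simp: subalgebra_def)
      have "\<bar>indicator A x *\<^sub>R c - indicator B x * c\<bar> = \<bar>c\<bar> * indicator ((A - B) \<union> (B - A)) x" for x
        by (auto simp: indicator_def)
      then have "expectation (\<lambda>x. \<bar>indicator A x *\<^sub>R c - indicator B x * c\<bar>) = \<bar>c\<bar> * prob ((A - B) \<union> (B - A))"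
        by simp
      also have "\<dots> \<le> (\<bar>c\<bar> + 1) * prob ((A - B) \<union> (B - A))"
        by (intro mult_right_mono) auto
      also have "\<dots> < e" using B(2) by (simp add: field_simps)
      finally have "expectation (\<lambda>x. \<bar>indicator A x *\<^sub>R c - indicator B x * c\<bar>) < e" .
      moreover have "(\<lambda>x. indicator B x * c) \<in> borel_measurable (H n)"
        using B(1) by measurable
      moreover have "integrable M (\<lambda>x. indicator B x * c)"
        by (intro integrable_mult_left integrable_real_indicator) (auto simp: emeasure_eq_measure)
      ultimately show "\<exists>n g. g \<in> borel_measurable (H n) \<and> integrable M g \<and> expectation (\<lambda>x. \<bar>indicator A x *\<^sub>R c - g x\<bar>) < e"
        by blast
    qed
  next
    case (add f1 f2)
    note f = integrable_from_subalg[OF F add(1)] integrable_from_subalg[OF F add(2)]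
    show ?case
    proof (intro allI impI)
      fix e :: real assume "e > 0"
      then have "e / 2 > 0" by simp
      obtain n1 g1 where g1: "g1 \<in> borel_measurable (H n1)" "integrable M g1" "expectation (\<lambda>x. \<bar>f1 x - g1 x\<bar>) < e / 2"
        using add(3) \<open>e / 2 > 0\<close> by blast
      obtain n2 g2 where g2: "g2 \<in> borel_measurable (H n2)" "integrable M g2" "expectation (\<lambda>x. \<bar>f2 x - g2 x\<bar>) < e / 2"
        using add(4) \<open>e / 2 > 0\<close> by blast
      have "(\<lambda>x. g1 x + g2 x) \<in> borel_measurable (H (max n1 n2))"
        by (intro borel_measurable_add measurable_from_subalg[OF subalg_mono g1(1)]
            measurable_from_subalg[OF subalg_mono g2(1)]) auto
      moreover have "integrable M (\<lambda>x. g1 x + g2 x)" using g1 g2 by simp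
      moreover have "expectation (\<lambda>x. \<bar>f1 x + f2 x - (g1 x + g2 x)\<bar>)
          \<le> expectation (\<lambda>x. \<bar>f1 x - g1 x\<bar> + \<bar>f2 x - g2 x\<bar>)"
        by (rule integral_mono) (use f g1(2) g2(2) in \<open>auto\<close>)
      then have "expectation (\<lambda>x. \<bar>f1 x + f2 x - (g1 x + g2 x)\<bar>) < e"
        using f g1(2,3) g2(2,3) by simp
      ultimately show "\<exists>n g. g \<in> borel_measurable (H n) \<and> integrable M g \<and> expectation (\<lambda>x. \<bar>f1 x + f2 x - g x\<bar>) < e"
        by blast
    qed
  next
    case (lim f s)
    note f = integrable_from_subalg[OF F lim.hyps(4)]
    note s = integrable_from_subalg[OF F lim.hyps(1)]
    have "(\<lambda>i. expectation (\<lambda>x. \<bar>f x - s i x\<bar>)) \<longlonglongrightarrow> expectation (\<lambda>x. 0)"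
    proof (rule integral_dominated_convergence)
      show "integrable M (\<lambda>x. 3 * \<bar>f x\<bar>)" using f by simp
      show "AE x in M. (\<lambda>i. \<bar>f x - s i x\<bar>) \<longlonglongrightarrow> 0"
      proof (rule AE_I2)
        fix x assume "x \<in> space M"
        then have "(\<lambda>i. \<bar>f x - s i x\<bar>) \<longlonglongrightarrow> \<bar>f x - f x\<bar>"
          by (intro tendsto_intros lim.hyps(2)) (simp add: space_restr_to_subalg)
        then show "(\<lambda>i. \<bar>f x - s i x\<bar>) \<longlonglongrightarrow> 0" by simp
      qed
      show "AE x in M. norm \<bar>f x - s i x\<bar> \<le> 3 * \<bar>f x\<bar>" for i
      proof (rule AE_I2)
        fix x assume "x \<in> space M"
        then have "norm (s i x) \<le> 2 * norm (f x)" by (intro lim.hyps(3)) (simp add: space_restr_to_subalg)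
        then show "norm \<bar>f x - s i x\<bar> \<le> 3 * \<bar>f x\<bar>" by simp
      qed
    qed (use f s in auto)
    then have conv: "(\<lambda>i. expectation (\<lambda>x. \<bar>f x - s i x\<bar>)) \<longlonglongrightarrow> 0" by simp
    show ?case
    proof (intro allI impI)
      fix e :: real assume "e > 0"
      then have "e / 2 > 0" by simp
      then have "\<exists>i. expectation (\<lambda>x. \<bar>f x - s i x\<bar>) < e / 2"
        using eventually_happens'[OF sequentially_bot order_tendstoD(2)[OF conv]] by blast
      then obtain i where i: "expectation (\<lambda>x. \<bar>f x - s i x\<bar>) < e / 2" ..
      obtain n g where g: "g \<in> borel_measurable (H n)" "integrable M g" "expectation (\<lambda>x. \<bar>s i x - g x\<bar>) < e / 2"
        using lim.IH[of i] \<open>e / 2 > 0\<close> by blast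
      have "expectation (\<lambda>x. \<bar>f x - g x\<bar>) \<le> expectation (\<lambda>x. \<bar>f x - s i x\<bar> + \<bar>s i x - g x\<bar>)"
        by (rule integral_mono) (use f s g(2) in auto)
      also have "\<dots> < e" using i g(2,3) f s by simp
      finally show "\<exists>n g. g \<in> borel_measurable (H n) \<and> integrable M g \<and> expectation (\<lambda>x. \<bar>f x - g x\<bar>) < e"
        using g by blast
    qed
  qed
  with \<open>e > 0\<close> show ?thesis by blast
qed

text \<open>Let \<open>g\<close> be measurable at stage \<open>m\<close> and $W = |Z - g|$ have small expectation. From stage \<open>m\<close> on, conditioning
  does not change \<open>g\<close>, hence $|E[Z \mid H_n] - Z| \le E[W \mid H_n] + W$. The maximal inequality bounds
  the first term uniformly in \<open>n\<close>, Markov's inequality the second.\<close>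

lemma levy_upward_measurable:
  assumes F: "subalgebra M F" and dense: "sets F \<subseteq> approximable_events"
    and Z: "integrable M Z" "Z \<in> borel_measurable F"
  shows "AE x in M. (\<lambda>n. real_cond_exp M (H n) Z x) \<longlonglongrightarrow> Z x"
proof -
  have [measurable]: "Z \<in> borel_measurable M" using Z(1) by simp
  have close: "AE x in M. \<forall>\<^sub>F n in sequentially. \<bar>real_cond_exp M (H n) Z x - Z x\<bar> < 3 * e" if "e > 0" for e :: real
  proof -
    define Bad where "Bad = {x \<in> space M. \<not> (\<forall>\<^sub>F n in sequentially. \<bar>real_cond_exp M (H n) Z x - Z x\<bar> < 3 * e)}"
    have [measurable]: "Bad \<in> sets M" unfolding Bad_def by measurable
    \<comment> \<open>The constant is 2 because two events, one for each term of the bound, have to be avoided.\<close>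
    have small: "prob Bad \<le> 2 * \<delta>" if "\<delta> > 0" for \<delta>
    proof -
      have "\<delta> * e > 0" using \<open>\<delta> > 0\<close> \<open>e > 0\<close> by simp
      from integrable_approximation[OF F dense Z this]
      obtain m g where g: "g \<in> borel_measurable (H m)" "integrable M g"
        "expectation (\<lambda>x. \<bar>Z x - g x\<bar>) < \<delta> * e" by blast
      define W where "W x = \<bar>Z x - g x\<bar>" for x
      have W: "integrable M W" "\<And>x. W x \<ge> 0" unfolding W_def using Z(1) g(2) by auto
      have [measurable]: "W \<in> borel_measurable M" using W(1) by simp
      define U1 where "U1 = {x \<in> space M. \<exists>n. real_cond_exp M (H (m + n)) W x > e}"
      define U2 where "U2 = {x \<in> space M. W x \<ge> e}"
      have [measurable]: "U1 \<in> sets M" "U2 \<in> sets M" unfolding U1_def U2_def by measurable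
      interpret shift: filtered_prob_space M "\<lambda>n. H (m + n)" by (rule filtered_prob_space_shift)
      have "prob U1 \<le> expectation W / e"
        unfolding U1_def by (rule shift.cond_exp_maximal_inequality) (use W \<open>e > 0\<close> in auto)
      moreover have "prob U2 \<le> expectation W / e"
        unfolding U2_def by (rule integral_Markov_inequality_measure[where A="{}"]) (use W \<open>e > 0\<close> in auto)
      moreover have "expectation W / e < \<delta>"
        using g(3) \<open>e > 0\<close> unfolding W_def by (simp add: pos_divide_less_eq)
      ultimately have U: "prob U1 + prob U2 \<le> 2 * \<delta>" by linarith
      have approx: "AE x in M. \<bar>real_cond_exp M (H (m + n)) Z x - g x\<bar> \<le> real_cond_exp M (H (m + n)) W x" for n
      proof -
        interpret sigma_finite_subalgebra M "H (m + n)" by (rule sigma_finite_subalg)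
        have "AE x in M. real_cond_exp M (H (m + n)) (\<lambda>x. Z x - g x) x = real_cond_exp M (H (m + n)) Z x - real_cond_exp M (H (m + n)) g x"
          by (rule real_cond_exp_diff) (use Z(1) g(2) in auto)
        moreover have "AE x in M. real_cond_exp M (H (m + n)) g x = g x"
          by (rule real_cond_exp_F_meas) (use g(2) measurable_from_subalg[OF subalg_mono g(1)] in auto)
        moreover have "AE x in M. real_cond_exp M (H (m + n)) (\<lambda>x. Z x - g x) x \<le> real_cond_exp M (H (m + n)) W x"
          by (rule real_cond_exp_mono) (use Z(1) g(2) W in \<open>auto simp: W_def\<close>)
        moreover have "AE x in M. real_cond_exp M (H (m + n)) (\<lambda>x. - (Z x - g x)) x \<le> real_cond_exp M (H (m + n)) W x"
          by (rule real_cond_exp_mono) (use Z(1) g(2) W in \<open>auto simp: W_def\<close>)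
        moreover have "AE x in M. real_cond_exp M (H (m + n)) (\<lambda>x. (-1) * (Z x - g x)) x = (-1) * real_cond_exp M (H (m + n)) (\<lambda>x. Z x - g x) x"
          by (rule real_cond_exp_cmult) (use Z(1) g(2) in auto)
        ultimately show ?thesis by eventually_elim auto
      qed
      have "AE x in M. \<forall>n. \<bar>real_cond_exp M (H (m + n)) Z x - g x\<bar> \<le> real_cond_exp M (H (m + n)) W x"
        unfolding AE_all_countable using approx by blast
      with AE_space have "AE x in M. x \<in> Bad \<longrightarrow> x \<in> U1 \<union> U2"
      proof eventually_elim
        case (elim x)
        then have "x \<in> space M"
          and bounds: "\<forall>n. \<bar>real_cond_exp M (H (m + n)) Z x - g x\<bar> \<le> real_cond_exp M (H (m + n)) W x"
          by simp_all
        show ?case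
        proof (rule impI, rule ccontr)
          assume "x \<in> Bad" "x \<notin> U1 \<union> U2"
          then have "real_cond_exp M (H (m + n)) W x \<le> e" "W x < e" for n
            using \<open>x \<in> space M\<close> by (auto simp: U1_def U2_def not_less not_le)
          moreover have "\<bar>real_cond_exp M (H (m + n)) Z x - g x\<bar> \<le> real_cond_exp M (H (m + n)) W x" for n
            using bounds by blast
          ultimately have "\<bar>real_cond_exp M (H (m + n)) Z x - Z x\<bar> < 3 * e" for n
            unfolding W_def by (smt (verit))
          then have "\<forall>\<^sub>F n in sequentially. \<bar>real_cond_exp M (H n) Z x - Z x\<bar> < 3 * e"
            unfolding eventually_sequentially by (metis le_iff_add)
          with \<open>x \<in> Bad\<close> show False by (simp add: Bad_def)
        qed
      qed
      then have "prob Bad \<le> prob (U1 \<union> U2)" by (intro finite_measure_mono_AE) auto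
      also have "\<dots> \<le> prob U1 + prob U2" by (rule measure_Un_le) auto
      finally show ?thesis using U by linarith
    qed
    have "prob Bad \<le> 0"
    proof (rule field_le_epsilon)
      fix d :: real assume "d > 0" then show "prob Bad \<le> 0 + d" using small[of "d / 2"] by simp
    qed
    then have "prob Bad = 0" by (simp add: measure_le_0_iff)
    then have "AE x in M. x \<notin> Bad" by (subst (asm) prob_eq_0) auto
    with AE_space show ?thesis by eventually_elim (simp add: Bad_def)
  qed
  have "AE x in M. \<forall>k. \<forall>\<^sub>F n in sequentially. \<bar>real_cond_exp M (H n) Z x - Z x\<bar> < 3 * (1 / real (Suc k))"
    unfolding AE_all_countable by (intro allI close) simp
  then show ?thesis
  proof eventually_elim
    case (elim x)
    show ?case
    proof (rule tendstoI)
      fix e :: real assume "e > 0"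
      then obtain k where k: "1 / real (Suc k) < e / 3"
        using nat_approx_posE[of "e / 3"] by auto
      from spec[OF elim, of k] show "\<forall>\<^sub>F n in sequentially. dist (real_cond_exp M (H n) Z x) (Z x) < e"
        by (rule eventually_mono) (use k in \<open>simp add: dist_real_def\<close>)
    qed
  qed
qed

theorem levy_upward:
  assumes F: "subalgebra M F" and dense: "sets F \<subseteq> approximable_events" and H_F: "\<And>n. subalgebra F (H n)"
    and Y: "integrable M Y"
  shows "AE x in M. (\<lambda>n. real_cond_exp M (H n) Y x) \<longlonglongrightarrow> real_cond_exp M F Y x"
proof -
  interpret F: sigma_finite_subalgebra M F
    by (intro finite_measure_subalgebra_is_sigma_finite finite_measure_subalgebra.intro
      finite_measure_axioms finite_measure_subalgebra_axioms.intro F)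
  have "AE x in M. \<forall>n. real_cond_exp M (H n) (real_cond_exp M F Y) x = real_cond_exp M (H n) Y x"
    unfolding AE_all_countable
  proof
    fix n
    interpret sigma_finite_subalgebra M "H n" by (rule sigma_finite_subalg)
    show "AE x in M. real_cond_exp M (H n) (real_cond_exp M F Y) x = real_cond_exp M (H n) Y x"
      by (rule real_cond_exp_nested_subalg[OF F H_F Y])
  qed
  moreover have "AE x in M. (\<lambda>n. real_cond_exp M (H n) (real_cond_exp M F Y) x) \<longlonglongrightarrow> real_cond_exp M F Y x"
    by (rule levy_upward_measurable[OF F dense]) (use F.real_cond_exp_int(1)[OF Y] in auto)
  ultimately show ?thesis by eventually_elim simp
qed

end

section \<open>Recurrence and first returns under a stationary law\<close>

definition path_shift :: "int \<Rightarrow> (int \<Rightarrow> real) \<Rightarrow> int \<Rightarrow> real" where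
  "path_shift k x = (\<lambda>n. x (n + k))"

lemma path_shift_shift [simp]: "path_shift j (path_shift k x) = path_shift (j + k) x"
  by (simp add: path_shift_def ac_simps)

lemma path_shift_0 [simp]: "path_shift 0 x = x"
  by (simp add: path_shift_def)

lemma measurable_path_shift [measurable]: "path_shift k \<in> path_space \<rightarrow>\<^sub>M path_space"
  unfolding path_shift_def by (rule measurable_PiM_single') auto

lemma space_path_space [simp]: "space path_space = UNIV"
  by (simp add: space_PiM)

locale stationary_path_measure = prob_space \<mu> for \<mu> :: "(int \<Rightarrow> real) measure" +
  assumes sets_eq [measurable_cong]: "sets \<mu> = sets path_space"
    and invariant: "\<And>k A. A \<in> sets path_space \<Longrightarrow> prob (path_shift k -` A) = prob A"
begin

lemma space_eq [simp]: "space \<mu> = UNIV"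
  using sets_eq_imp_space_eq[OF sets_eq] by simp

text \<open>The points of \<open>A\<close> that never come back form a wandering set: its preimages under different
  powers of the shift are disjoint and have equal probability, which must therefore be \<open>0\<close>. Both
  directions of time are needed below, hence the factor \<open>s\<close>.\<close>

lemma poincare_recurrence:
  assumes A [measurable]: "A \<in> sets path_space"
  shows "AE x in \<mu>. x \<in> A \<longrightarrow> (\<exists>t::nat>0. path_shift (s * int t) x \<in> A)"
proof -
  define W where "W = {x. x \<in> A \<and> \<not> (\<exists>t::nat>0. path_shift (s * int t) x \<in> A)}"
  have W [measurable]: "W \<in> sets path_space"
  proof -
    have "W = {x \<in> space path_space. x \<in> A \<and> \<not> (\<exists>t::nat\<in>{0<..}. path_shift (s * int t) x \<in> A)}"
      unfolding W_def space_path_space by blast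
    also have "\<dots> \<in> sets path_space" by measurable
    finally show ?thesis .
  qed
  define V where "V t = path_shift (s * int t) -` W" for t
  have V_meas: "V t \<in> sets \<mu>" for t
    using measurable_sets[OF measurable_path_shift W] by (simp add: V_def sets_eq)
  have "V i \<inter> V j = {}" if "i < j" for i j
  proof -
    have False if "x \<in> V i" "x \<in> V j" for x
    proof -
      have "path_shift (s * int j) x = path_shift (s * int (j - i)) (path_shift (s * int i) x)"
        using \<open>i < j\<close> by (simp add: of_nat_diff algebra_simps)
      moreover have "j - i > 0" using \<open>i < j\<close> by simp
      ultimately show False using that unfolding V_def W_def by (metis (no_types, lifting) mem_Collect_eq vimage_eq)
    qed
    then show ?thesis by blast
  qed
  then have "disjoint_family V"
    by (auto simp: disjoint_family_on_def) (metis disjoint_iff linorder_neqE_nat)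
  then have "(\<lambda>t. prob (V t)) sums prob (\<Union>t. V t)"
    using V_meas by (intro finite_measure_UNION) auto
  moreover have "prob (V t) = prob W" for t
    unfolding V_def by (rule invariant) simp
  ultimately have "summable (\<lambda>t::nat. prob W)" by (simp add: sums_iff)
  then have "prob W = 0" by (simp add: summable_const_iff)
  then have "AE x in \<mu>. x \<notin> W" by (subst (asm) prob_eq_0) (auto simp: sets_eq)
  then show ?thesis by eventually_elim (auto simp: W_def)
qed

text \<open>The transformation that sends a visit to \<open>A\<close> to the previous visit preserves the law on \<open>A\<close>.
  Split by the waiting time \<open>t\<close> and shift by \<open>t\<close>: ``\<open>A\<close> now, and last visited \<open>t\<close> steps ago in \<open>V\<close>'' becomes
  ``\<open>A\<close> and \<open>V\<close> now, and next visit to \<open>A\<close> in \<open>t\<close> steps''. Summed over \<open>t\<close>, the latter events fill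
  \<open>A \<inter> V\<close> up to a null set, as almost every visit is followed by another one.\<close>

lemma first_return_measure_preserving:
  assumes A [measurable]: "A \<in> sets path_space" and V [measurable]: "V \<in> sets path_space"
  shows "prob {x \<in> A. path_shift (- int (LEAST t. t > 0 \<and> path_shift (- int t) x \<in> A)) x \<in> V} = prob (A \<inter> V)"
proof -
  define ret where "ret x = (LEAST t. t > 0 \<and> path_shift (- int t) x \<in> A)" for x
  define R where "R t = {x \<in> A. t > 0 \<and> path_shift (- int t) x \<in> A \<and> (\<forall>s\<in>{0<..<t}. path_shift (- int s) x \<notin> A)
    \<and> path_shift (- int t) x \<in> V}" for t
  define Q where "Q t = {x \<in> A. t > 0 \<and> path_shift (int t) x \<in> A \<and> (\<forall>s\<in>{0<..<t}. path_shift (int s) x \<notin> A)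
    \<and> x \<in> V}" for t
  have R_meas: "R t \<in> sets \<mu>" for t
  proof -
    have "R t = {x \<in> space path_space. x \<in> A \<and> t > 0 \<and> path_shift (- int t) x \<in> A \<and> (\<forall>s\<in>{0<..<t}. path_shift (- int s) x \<notin> A)
      \<and> path_shift (- int t) x \<in> V}" by (auto simp: R_def)
    also have "\<dots> \<in> sets path_space" by measurable
    finally show ?thesis by (simp add: sets_eq)
  qed
  have Q_meas: "Q t \<in> sets path_space" for t
  proof -
    have "Q t = {x \<in> space path_space. x \<in> A \<and> t > 0 \<and> path_shift (int t) x \<in> A \<and> (\<forall>s\<in>{0<..<t}. path_shift (int s) x \<notin> A)
      \<and> x \<in> V}" by (auto simp: Q_def)
    also have "\<dots> \<in> sets path_space" by measurable
    finally show ?thesis .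
  qed
  have "False" if "x \<in> R i" "x \<in> R j" "i < j" for x i j
    using that by (auto simp: R_def)
  moreover have "False" if "x \<in> Q i" "x \<in> Q j" "i < j" for x i j
    using that by (auto simp: Q_def)
  ultimately have "disjoint_family R" "disjoint_family Q"
    unfolding disjoint_family_on_def by (metis disjoint_iff linorder_neqE_nat)+
  then have R_sums: "(\<lambda>t. prob (R t)) sums prob (\<Union>t. R t)"
    and Q_sums: "(\<lambda>t. prob (Q t)) sums prob (\<Union>t. Q t)"
    using R_meas Q_meas by (auto intro!: finite_measure_UNION simp: sets_eq)
  \<comment> \<open>Seen from the earlier visit, the visit-free times in between are counted from the other end.\<close>
  have "R t = path_shift (- int t) -` Q t" for t
  proof -
    have "(\<forall>s\<in>{0<..<t}. path_shift (- int s) x \<notin> A) \<longleftrightarrow> (\<forall>s\<in>{0<..<t}. path_shift (int s) (path_shift (- int t) x) \<notin> A)" for x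
    proof -
      have reflect: "(\<forall>s\<in>{0<..<t}. P s) \<longleftrightarrow> (\<forall>s\<in>{0<..<t}. P (t - s))" for P :: "nat \<Rightarrow> bool"
      proof (intro iffI ballI)
        fix s assume "\<forall>s\<in>{0<..<t}. P (t - s)" "s \<in> {0<..<t}"
        then show "P s" by (auto dest!: bspec[where x="t - s"])
      qed auto
      have "path_shift (int s) (path_shift (- int t) x) = path_shift (- int (t - s)) x" if "s \<in> {0<..<t}" for s
        using that by (simp add: of_nat_diff)
      then show ?thesis by (subst reflect) simp
    qed
    then show ?thesis by (auto simp: R_def Q_def)
  qed
  then have "prob (R t) = prob (Q t)" for t
    using invariant[OF Q_meas] by simp
  then have "prob (\<Union>t. R t) = prob (\<Union>t. Q t)"
    using R_sums Q_sums by (simp add: sums_iff)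
  moreover have R_UN: "(\<Union>t. R t) = {x \<in> A. (\<exists>t>0. path_shift (- int t) x \<in> A) \<and> path_shift (- int (ret x)) x \<in> V}"
  proof -
    have "x \<in> R (ret x)" if "x \<in> A" "t > 0" "path_shift (- int t) x \<in> A" "path_shift (- int (ret x)) x \<in> V" for x t
    proof -
      have "ret x > 0 \<and> path_shift (- int (ret x)) x \<in> A"
        unfolding ret_def by (rule LeastI[where P="\<lambda>t. t > 0 \<and> path_shift (- int t) x \<in> A"]) (use that in auto)
      moreover have "path_shift (- int s) x \<notin> A" if "s \<in> {0<..<ret x}" for s
        using not_less_Least[of s "\<lambda>t. t > 0 \<and> path_shift (- int t) x \<in> A"] that by (auto simp: ret_def)
      ultimately show ?thesis using that(1,4) unfolding R_def by blast
    qed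
    moreover have "ret x = t" if "x \<in> R t" for x t
      unfolding ret_def
    proof (rule Least_equality)
      fix s assume s: "s > 0 \<and> path_shift (- int s) x \<in> A"
      show "t \<le> s"
        by (rule ccontr) (use s that in \<open>auto simp: R_def\<close>)
    qed (use that in \<open>simp add: R_def\<close>)
    then have "x \<in> A \<and> (\<exists>t>0. path_shift (- int t) x \<in> A) \<and> path_shift (- int (ret x)) x \<in> V"
      if "x \<in> R t" for x t
      using that unfolding R_def by auto
    ultimately show ?thesis unfolding set_eq_iff UN_iff mem_Collect_eq by (meson UNIV_I)
  qed
  moreover have Q_UN: "(\<Union>t. Q t) = {x \<in> A. (\<exists>t>0. path_shift (int t) x \<in> A) \<and> x \<in> V}"
  proof -
    have "\<exists>t. x \<in> Q t" if "x \<in> A" "t > 0" "path_shift (int t) x \<in> A" "x \<in> V" for x t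
    proof -
      let ?t = "LEAST t. t > 0 \<and> path_shift (int t) x \<in> A"
      have "?t > 0 \<and> path_shift (int ?t) x \<in> A"
        by (rule LeastI[where P="\<lambda>t. t > 0 \<and> path_shift (int t) x \<in> A"]) (use that in auto)
      moreover have "path_shift (int s) x \<notin> A" if "s \<in> {0<..<?t}" for s
        using not_less_Least[of s "\<lambda>t. t > 0 \<and> path_shift (int t) x \<in> A"] that by auto
      ultimately have "x \<in> Q ?t" using that(1,4) unfolding Q_def by blast
      then show ?thesis by blast
    qed
    moreover have "x \<in> A \<and> (\<exists>t>0. path_shift (int t) x \<in> A) \<and> x \<in> V" if "x \<in> Q t" for x t
      using that unfolding Q_def by auto
    ultimately show ?thesis unfolding set_eq_iff UN_iff mem_Collect_eq by (meson UNIV_I)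
  qed
  moreover have "prob {x \<in> A. (\<exists>t>0. path_shift (- int t) x \<in> A) \<and> path_shift (- int (ret x)) x \<in> V}
      = prob {x \<in> A. path_shift (- int (ret x)) x \<in> V}"
  proof (rule measure_eq_AE)
    have ret_meas [measurable]: "ret \<in> path_space \<rightarrow>\<^sub>M count_space UNIV"
      unfolding ret_def by measurable
    have [measurable]: "(\<lambda>x. path_shift (- int (ret x)) x) \<in> path_space \<rightarrow>\<^sub>M path_space"
      by (rule measurable_compose_countable[where f="\<lambda>t x. path_shift (- int t) x" and g=ret]) measurable
    have "{x \<in> A. path_shift (- int (ret x)) x \<in> V} = {x \<in> space path_space. x \<in> A \<and> path_shift (- int (ret x)) x \<in> V}"
      by auto
    also have "\<dots> \<in> sets path_space" by measurable
    finally show "{x \<in> A. path_shift (- int (ret x)) x \<in> V} \<in> sets \<mu>" by (simp add: sets_eq)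
    show "AE x in \<mu>. (x \<in> {x \<in> A. (\<exists>t>0. path_shift (- int t) x \<in> A) \<and> path_shift (- int (ret x)) x \<in> V})
      = (x \<in> {x \<in> A. path_shift (- int (ret x)) x \<in> V})"
      using poincare_recurrence[OF A, of "-1"] by eventually_elim auto
    show "{x \<in> A. (\<exists>t>0. path_shift (- int t) x \<in> A) \<and> path_shift (- int (ret x)) x \<in> V} \<in> sets \<mu>"
      using sets.countable_UN[of R UNIV \<mu>] R_meas unfolding R_UN by blast
  qed
  moreover have "prob {x \<in> A. (\<exists>t>0. path_shift (int t) x \<in> A) \<and> x \<in> V} = prob (A \<inter> V)"
  proof (rule measure_eq_AE)
    show "AE x in \<mu>. (x \<in> {x \<in> A. (\<exists>t>0. path_shift (int t) x \<in> A) \<and> x \<in> V}) = (x \<in> A \<inter> V)"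
      using poincare_recurrence[OF A, of 1] by eventually_elim auto
    show "{x \<in> A. (\<exists>t>0. path_shift (int t) x \<in> A) \<and> x \<in> V} \<in> sets \<mu>"
      using sets.countable_UN[of Q UNIV \<mu>] Q_meas unfolding Q_UN sets_eq by blast
  qed (simp add: sets_eq)
  ultimately show ?thesis by (simp add: ret_def)
qed

end

section \<open>Quantizers and quantized matches\<close>

locale quantizing_partitions =
  fixes \<P> :: "nat \<Rightarrow> real set set"
  assumes admissible: "admissible_partitions \<P>"
begin

lemma finite_cells: "k \<ge> 1 \<Longrightarrow> finite (\<P> k)"
  and cells_partition: "k \<ge> 1 \<Longrightarrow> partition_on UNIV (\<P> k)"
  and cell_interval: "k \<ge> 1 \<Longrightarrow> A \<in> \<P> k \<Longrightarrow> right_semiclosed_interval A"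
  and refining: "k \<ge> 1 \<Longrightarrow> sigma_sets UNIV (\<P> k) \<subseteq> sigma_sets UNIV (\<P> (Suc k))"
  and generating: "sigma_sets UNIV (\<Union>k\<in>{1..}. sigma_sets UNIV (\<P> k)) = sets borel"
  using admissible by (auto simp: admissible_partitions_def)

lemma ex1_cell:
  assumes "k \<ge> 1" shows "\<exists>!A. A \<in> \<P> k \<and> x \<in> A"
proof -
  have "x \<in> \<Union>(\<P> k)" "disjoint (\<P> k)"
    using partition_onD1[OF cells_partition[OF assms]] partition_onD2[OF cells_partition[OF assms]] by auto
  then show ?thesis by (auto dest: disjointD)
qed

lemma quantizer_cell: "k \<ge> 1 \<Longrightarrow> quantizer \<P> k x \<in> \<P> k \<and> x \<in> quantizer \<P> k x"
  unfolding quantizer_def by (rule theI') (rule ex1_cell)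

lemma quantizer_eqI: "k \<ge> 1 \<Longrightarrow> A \<in> \<P> k \<Longrightarrow> x \<in> A \<Longrightarrow> quantizer \<P> k x = A"
  using ex1_cell quantizer_cell by blast

lemma sigma_cells_borel:
  assumes "k \<ge> 1" "C \<in> sigma_sets UNIV (\<P> k)" shows "C \<in> sets borel"
proof -
  have "C \<in> sigma_sets UNIV (\<Union>k\<in>{1..}. sigma_sets UNIV (\<P> k))"
    by (rule sigma_sets.Basic) (use assms in auto)
  then show ?thesis using generating by simp
qed

lemma cell_borel: "k \<ge> 1 \<Longrightarrow> A \<in> \<P> k \<Longrightarrow> A \<in> sets borel"
  by (rule sigma_cells_borel) (auto intro: sigma_sets.Basic)

text \<open>A set generated by a partition is a union of its cells, so it cannot separate two points of the
  same cell.\<close>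

lemma sigma_cells_saturated:
  assumes "k \<ge> 1" and C: "C \<in> sigma_sets UNIV (\<P> k)" and eq: "quantizer \<P> k x = quantizer \<P> k y"
  shows "x \<in> C \<longleftrightarrow> y \<in> C"
  using C
proof induction
  case (Basic A)
  then show ?case using quantizer_eqI[OF \<open>k \<ge> 1\<close>] quantizer_cell[OF \<open>k \<ge> 1\<close>] eq by metis
qed auto

lemma quantizer_coarsen:
  assumes "1 \<le> j" "j \<le> k" "quantizer \<P> k x = quantizer \<P> k y"
  shows "quantizer \<P> j x = quantizer \<P> j y"
  using assms(2,3)
proof (induction k rule: dec_induct)
  case (step k)
  have "quantizer \<P> k y \<in> sigma_sets UNIV (\<P> (Suc k))"
    using refining[of k] quantizer_cell[of k y] step(1) \<open>1 \<le> j\<close> by (auto intro: sigma_sets.Basic)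
  then have "x \<in> quantizer \<P> k y \<longleftrightarrow> y \<in> quantizer \<P> k y"
    by (intro sigma_cells_saturated) (use step.prems in auto)
  then have "quantizer \<P> k x = quantizer \<P> k y"
    using quantizer_cell[of k y] step(1) \<open>1 \<le> j\<close> by (intro quantizer_eqI) auto
  then show ?case by (rule step.IH)
qed

text \<open>As the partitions generate the Borel sets, some partition separates \<open>x\<close> from \<open>y\<close>. The cell of \<open>x\<close> is
  an interval closed on the right, so its right end point \<open>b\<close> lies in \<open>{x..<y}\<close>, and the cells that meet
  \<open>{..x}\<close> together make up \<open>{..b}\<close>.\<close>

lemma half_lines_dense:
  assumes "x < y"
  shows "\<exists>k\<ge>1. \<exists>Q\<subseteq>\<P> k. \<exists>b. \<Union>Q = {..b} \<and> x \<le> b \<and> b < y"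
proof -
  have "\<exists>k\<ge>1. quantizer \<P> k x \<noteq> quantizer \<P> k y"
  proof (rule ccontr)
    assume "\<not> ?thesis"
    then have eq: "quantizer \<P> k x = quantizer \<P> k y" if "k \<ge> 1" for k using that by blast
    have "x \<in> C \<longleftrightarrow> y \<in> C" if "C \<in> sigma_sets UNIV (\<Union>k\<in>{1..}. sigma_sets UNIV (\<P> k))" for C
      using that
    proof induction
      case (Basic A)
      then obtain k where "k \<ge> 1" "A \<in> sigma_sets UNIV (\<P> k)" by auto
      then show ?case using sigma_cells_saturated eq by blast
    qed auto
    from this[of "{x}"] show False using \<open>x < y\<close> unfolding generating by simp
  qed
  then obtain k where k: "k \<ge> 1" "quantizer \<P> k x \<noteq> quantizer \<P> k y" by blast
  obtain a b where ab: "quantizer \<P> k x = {z. a < ereal z \<and> ereal z \<le> b}"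
    using cell_interval[OF k(1)] quantizer_cell[OF k(1), of x] unfolding right_semiclosed_interval_def by blast
  have x: "a < ereal x" "ereal x \<le> b" using quantizer_cell[OF k(1), of x] ab by auto
  have "y \<notin> quantizer \<P> k x" using quantizer_eqI[OF k(1)] quantizer_cell[OF k(1)] k(2) by metis
  moreover have "a < ereal y" using x(1) \<open>x < y\<close> by (meson ereal_less(1) less_ereal.simps(1) less_trans)
  ultimately have "b < ereal y" using ab by auto
  then obtain c where c: "b = ereal c" using x(2) by (cases b) auto
  define Q where "Q = {A \<in> \<P> k. \<exists>z\<in>A. z \<le> x}"
  have "\<Union>Q = {..c}"
  proof (intro set_eqI iffI)
    fix z assume "z \<in> \<Union>Q"
    then obtain A w where A: "A \<in> \<P> k" "z \<in> A" "w \<in> A" "w \<le> x" by (auto simp: Q_def)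
    show "z \<in> {..c}"
    proof (rule ccontr)
      assume "z \<notin> {..c}"
      then have "x \<le> z" using x(2) c by auto
      obtain a' b' where "A = {z. a' < ereal z \<and> ereal z \<le> b'}"
        using cell_interval[OF k(1) A(1)] unfolding right_semiclosed_interval_def by blast
      moreover have "ereal w \<le> ereal x" "ereal x \<le> ereal z" using A(4) \<open>x \<le> z\<close> by simp_all
      ultimately have "x \<in> A" using A(2,3) 
        by (auto intro: less_le_trans[of a' "ereal w" "ereal x"] order_trans[of "ereal x" "ereal z" b'])
      then have "A = quantizer \<P> k x" using quantizer_eqI[OF k(1) A(1)] by simp
      then show False using A(2) \<open>z \<notin> {..c}\<close> ab c by auto
    qed
  next
    fix z assume z: "z \<in> {..c}"
    show "z \<in> \<Union>Q"
    proof (cases "z \<le> x")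
      case True
      then have "quantizer \<P> k z \<in> Q" using quantizer_cell[OF k(1), of z] unfolding Q_def by blast
      then show ?thesis using quantizer_cell[OF k(1), of z] by blast
    next
      case False
      then have "z \<in> quantizer \<P> k x"
        using z ab c less_trans[OF x(1), of "ereal z"] by simp
      moreover have "quantizer \<P> k x \<in> Q" using quantizer_cell[OF k(1), of x] unfolding Q_def by blast
      ultimately show ?thesis by blast
    qed
  qed
  moreover have "Q \<subseteq> \<P> k" by (auto simp: Q_def)
  moreover have "x \<le> c" "c < y" using x(2) \<open>b < ereal y\<close> c by auto
  ultimately show ?thesis using k(1) by blast
qed

definition matches :: "(int \<Rightarrow> real) \<Rightarrow> nat \<Rightarrow> nat \<Rightarrow> nat \<Rightarrow> bool" where
  "matches x k l t \<longleftrightarrow> (\<forall>n\<in>{- int l..-1}. quantizer \<P> k (x (n - int t)) = quantizer \<P> k (x n))"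

lemma map_block_eq_iff:
  "map f (block x (- int l - int t) (- 1 - int t)) = map g (block y (- int l) (- 1)) \<longleftrightarrow>
    (\<forall>n\<in>{- int l..-1}. f (x (n - int t)) = g (y n))"
proof -
  have "block x (- int l - int t) (- 1 - int t) = map (\<lambda>n. x (n - int t)) [- int l..-1]"
    unfolding block_def
    by (rule nth_equalityI) (auto simp: nth_upto algebra_simps)
  then show ?thesis by (auto simp: block_def)
qed

lemma recurrence_time_alt: "recurrence_time \<P> x k l = (LEAST t. t > 0 \<and> matches x k l t)"
  unfolding recurrence_time_def matches_def map_block_eq_iff ..

text \<open>This makes every \<open>LEAST\<close> in the recursive construction attained. It asks for matches of blocks of
  all lengths, not only of the lengths that the construction produces, because the blocks of a fixed
  length are directly accessible to Poincare's theorem.\<close>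

definition recurrent :: "(int \<Rightarrow> real) \<Rightarrow> bool" where
  "recurrent x \<longleftrightarrow> (\<forall>k l. \<exists>t>0. matches x (Suc k) l t)"

lemma recurrence_time:
  assumes "recurrent x" "k \<ge> 1"
  shows "recurrence_time \<P> x k l > 0" "matches x k l (recurrence_time \<P> x k l)"
proof -
  have "\<exists>t. t > 0 \<and> matches x k l t" using assms by (cases k) (auto simp: recurrent_def)
  from LeastI_ex[OF this] show "recurrence_time \<P> x k l > 0" "matches x k l (recurrence_time \<P> x k l)"
    unfolding recurrence_time_alt by auto
qed

lemma match_len_gt:
  assumes "recurrent x" shows "match_len \<P> x k > k"
proof (induction k)
  case (Suc k) then show ?case using recurrence_time(1)[OF assms, of "Suc k" "match_len \<P> x k"] by simp
qed simp

definition agree :: "nat \<Rightarrow> nat \<Rightarrow> (int \<Rightarrow> real) \<Rightarrow> (int \<Rightarrow> real) \<Rightarrow> bool" where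
  "agree k l x y \<longleftrightarrow> (\<forall>n\<in>{- int l..-1}. quantizer \<P> k (x n) = quantizer \<P> k (y n))"

lemma agree_coarsen:
  assumes "agree k l x y" "1 \<le> j" "j \<le> k" "i \<le> l" shows "agree j i x y"
  unfolding agree_def
proof
  fix n assume "n \<in> {- int i..-1}"
  then show "quantizer \<P> j (x n) = quantizer \<P> j (y n)"
    using assms by (intro quantizer_coarsen[of j k]) (auto simp: agree_def)
qed

text \<open>The search for a match looks no further back than the match that it finds. So a second trajectory
  with the same quantized values up to there passes through the same search.\<close>

lemma recurrence_time_agree:
  assumes "recurrent x" "k \<ge> 1" and ag: "agree k (recurrence_time \<P> x k l + l) x y"
  shows "recurrence_time \<P> y k l = recurrence_time \<P> x k l"
proof -
  let ?T = "recurrence_time \<P> x k l"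
  have same: "matches y k l t \<longleftrightarrow> matches x k l t" if "t \<le> ?T" for t
  proof -
    have "quantizer \<P> k (x n) = quantizer \<P> k (y n)" "quantizer \<P> k (x (n - int t)) = quantizer \<P> k (y (n - int t))"
      if "n \<in> {- int l..-1}" for n
      using ag that \<open>t \<le> ?T\<close> unfolding agree_def by auto
    then show ?thesis unfolding matches_def by auto
  qed
  show ?thesis
    unfolding recurrence_time_alt[of y]
  proof (rule Least_equality)
    show "?T > 0 \<and> matches y k l ?T" using recurrence_time[OF assms(1,2)] same by blast
    fix t assume t: "t > 0 \<and> matches y k l t"
    show "?T \<le> t"
    proof (rule ccontr)
      assume "\<not> ?T \<le> t"
      then have "t > 0 \<and> matches x k l t" using t same by simp
      then show False using not_less_Least[of t "\<lambda>t. t > 0 \<and> matches x k l t"] \<open>\<not> ?T \<le> t\<close>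
        unfolding recurrence_time_alt by simp
    qed
  qed
qed

text \<open>Each $\lambda_i$ is decided inside the block of its own length: the stages up to \<open>i\<close> search only there,
  and with quantizers that the \<open>k\<close>-th one refines.\<close>

lemma match_len_agree:
  assumes "recurrent x" "agree k l x y" "match_len \<P> x i \<le> l" "i \<le> k"
  shows "match_len \<P> y i = match_len \<P> x i"
  using assms(3,4)
proof (induction i)
  case (Suc i)
  let ?T = "recurrence_time \<P> x (Suc i) (match_len \<P> x i)"
  have "match_len \<P> y i = match_len \<P> x i" using Suc by simp
  moreover have "recurrence_time \<P> y (Suc i) (match_len \<P> x i) = ?T"
    by (rule recurrence_time_agree[OF assms(1)]) (use Suc.prems assms(2) in \<open>auto intro: agree_coarsen\<close>)
  ultimately show ?case by simp
qed simp

lemma match_count_at_top: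
  assumes "recurrent x" shows "filterlim (match_count \<P> x) at_top sequentially"
  unfolding filterlim_at_top
proof
  fix k
  have finite: "finite {k. match_len \<P> x k \<le> t}" for t
  proof (rule finite_subset)
    show "{k. match_len \<P> x k \<le> t} \<subseteq> {..t}"
    proof
      fix k assume "k \<in> {k. match_len \<P> x k \<le> t}"
      then show "k \<in> {..t}" using match_len_gt[OF assms, of k] by simp
    qed
  qed simp
  show "\<forall>\<^sub>F t in sequentially. k \<le> match_count \<P> x t"
    using eventually_ge_at_top[of "match_len \<P> x k"]
    unfolding match_count_def by (rule eventually_mono) (intro Max_ge finite, simp)
qed


end

section \<open>The process, its past and its almost sure recurrence\<close>

locale recurrence_forecasting = prob_space M + quantizing_partitions \<P>
  for M :: "'a measure" and \<P> :: "nat \<Rightarrow> real set set" +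
  fixes X :: "int \<Rightarrow> 'a \<Rightarrow> real"
  assumes random_variable [measurable]: "\<And>n. X n \<in> borel_measurable M"
    and stationary: "stationary_process M X"
begin

abbreviation trajectory :: "'a \<Rightarrow> int \<Rightarrow> real" where
  "trajectory \<omega> \<equiv> (\<lambda>n. X n \<omega>)"

abbreviation past :: "'a measure" where
  "past \<equiv> past_algebra M X"

lemma measurable_trajectory [measurable]: "trajectory \<in> M \<rightarrow>\<^sub>M path_space"
  by (rule measurable_PiM_single') auto

lemma stationary_path_measure: "stationary_path_measure (distr M path_space trajectory)"
proof (intro stationary_path_measure.intro stationary_path_measure_axioms.intro)
  show "prob_space (distr M path_space trajectory)" by (rule prob_space_distr) simp
  fix k and A :: "(int \<Rightarrow> real) set" assume A [measurable]: "A \<in> sets path_space"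
  have [measurable]: "(\<lambda>\<omega> n. X (n + k) \<omega>) \<in> M \<rightarrow>\<^sub>M path_space"
    by (rule measurable_PiM_single') auto
  have "path_shift k -` A \<in> sets path_space"
    using measurable_sets[OF measurable_path_shift A] by simp
  then have "measure (distr M path_space trajectory) (path_shift k -` A) = prob (trajectory -` (path_shift k -` A) \<inter> space M)"
    by (intro measure_distr) auto
  also have "trajectory -` (path_shift k -` A) \<inter> space M = (\<lambda>\<omega> n. X (n + k) \<omega>) -` A \<inter> space M"
    by (auto simp: path_shift_def)
  also have "prob \<dots> = measure (distr M path_space (\<lambda>\<omega> n. X (n + k) \<omega>)) A"
    by (rule measure_distr[symmetric]) auto
  also have "distr M path_space (\<lambda>\<omega> n. X (n + k) \<omega>) = distr M path_space trajectory"
    using stationary unfolding stationary_process_def by blast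
  finally show "measure (distr M path_space trajectory) (path_shift k -` A) = measure (distr M path_space trajectory) A" .
qed simp

lemma space_past [simp]: "space past = space M"
  by (simp add: past_algebra_def)

lemma subalgebra_past: "subalgebra M past"
  unfolding subalgebra_def past_algebra_def
  by (intro conjI sets_image_in_sets measurable_restrict) auto

lemma measurable_past [measurable]:
  assumes "n \<le> -1" shows "X n \<in> borel_measurable past"
proof -
  have "(\<lambda>\<omega>. \<lambda>n\<in>{..-1}. X n \<omega>) \<in> past \<rightarrow>\<^sub>M PiM {..-1} (\<lambda>_. borel)"
    unfolding past_algebra_def by (rule measurable_vimage_algebra1) (auto simp: space_PiM)
  from measurable_compose[OF this measurable_component_singleton[of n]] assms
  show ?thesis by simp
qed

lemma past_imp_event: "A \<in> sets past \<Longrightarrow> A \<in> events"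
  using subalgebra_past by (auto simp: subalgebra_def)

lemma pred_quantizer_eq:
  assumes "k \<ge> 1" and f [measurable]: "f \<in> borel_measurable N" "g \<in> borel_measurable N"
  shows "Measurable.pred N (\<lambda>\<omega>. quantizer \<P> k (f \<omega>) = quantizer \<P> k (g \<omega>))"
proof -
  have "quantizer \<P> k x = quantizer \<P> k y \<longleftrightarrow> (\<exists>A\<in>\<P> k. x \<in> A \<and> y \<in> A)" for x y
    using quantizer_cell[OF \<open>k \<ge> 1\<close>] quantizer_eqI[OF \<open>k \<ge> 1\<close>] by metis
  moreover have "Measurable.pred N (\<lambda>\<omega>. \<exists>A\<in>\<P> k. f \<omega> \<in> A \<and> g \<omega> \<in> A)"
    using finite_cells[OF \<open>k \<ge> 1\<close>]
  proof (rule pred_intros_finite)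
    fix A assume "A \<in> \<P> k"
    then have [measurable]: "A \<in> sets borel" using cell_borel \<open>k \<ge> 1\<close> by blast
    show "Measurable.pred N (\<lambda>\<omega>. f \<omega> \<in> A \<and> g \<omega> \<in> A)" by measurable
  qed
  ultimately show ?thesis by simp
qed

lemma pred_matches [measurable]:
  assumes "k \<ge> 1" shows "Measurable.pred past (\<lambda>\<omega>. matches (trajectory \<omega>) k l t)"
  unfolding matches_def
  by (intro pred_intros_finite pred_quantizer_eq assms measurable_past) auto

lemma measurable_recurrence_time:
  assumes "k \<ge> 1" shows "(\<lambda>\<omega>. recurrence_time \<P> (trajectory \<omega>) k l) \<in> past \<rightarrow>\<^sub>M count_space UNIV"
  unfolding recurrence_time_alt
  by (intro measurable_Least pred_intros_logic pred_matches assms) auto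

lemma measurable_match_len [measurable]: "(\<lambda>\<omega>. match_len \<P> (trajectory \<omega>) n) \<in> past \<rightarrow>\<^sub>M count_space UNIV"
proof (induction n)
  case (Suc n)
  have "(\<lambda>\<omega>. recurrence_time \<P> (trajectory \<omega>) (Suc n) l + l) \<in> past \<rightarrow>\<^sub>M count_space UNIV" for l
    using measurable_recurrence_time[of "Suc n" l] by measurable
  from measurable_compose_countable[OF this Suc.IH] show ?case by simp
qed simp

lemma measurable_match_time [measurable]: "(\<lambda>\<omega>. match_time \<P> (trajectory \<omega>) (Suc n)) \<in> past \<rightarrow>\<^sub>M count_space UNIV"
  unfolding match_time_def
  using measurable_compose_countable[OF measurable_recurrence_time[of "Suc n"] measurable_match_len[of n]] by simp

lemma pred_recurrent [measurable]: "Measurable.pred past (\<lambda>\<omega>. recurrent (trajectory \<omega>))"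
  unfolding recurrent_def
  by (intro pred_intros_countable pred_intros_logic pred_matches) auto

text \<open>The trajectories whose last block reads \<open>b\<close>. Recurrence times are return times to such an event,
  see \<open>block_event_shift_iff\<close>.\<close>

definition block_event :: "nat \<Rightarrow> real set list \<Rightarrow> (int \<Rightarrow> real) set" where
  "block_event k b = {x. map (quantizer \<P> k) (block x (- int (length b)) (-1)) = b}"

lemma block_event_meas [measurable]:
  assumes "k \<ge> 1" and b: "b \<in> lists (\<P> k)"
  shows "block_event k b \<in> sets path_space"
proof -
  have "block_event k b = {x \<in> space path_space. \<forall>i\<in>{..<length b}. x (- int (length b) + int i) \<in> b ! i}"
  proof -
    have "quantizer \<P> k z = b ! i \<longleftrightarrow> z \<in> b ! i" if "i < length b" for i z
      using quantizer_cell[OF \<open>k \<ge> 1\<close>, of z] quantizer_eqI[OF \<open>k \<ge> 1\<close>, of "b ! i" z] b that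
      by (metis in_listsD nth_mem)
    moreover have "x \<in> block_event k b \<longleftrightarrow>
        (\<forall>i<length b. quantizer \<P> k (x (- int (length b) + int i)) = b ! i)" for x
      unfolding block_event_def block_def mem_Collect_eq list_eq_iff_nth_eq by (simp add: nth_upto)
    ultimately show ?thesis by (simp add: set_eq_iff Ball_def)
  qed
  moreover have "{x \<in> space path_space. \<forall>i\<in>{..<length b}. x (- int (length b) + int i) \<in> b ! i} \<in> sets path_space"
  proof (rule sets.sets_Collect_finite_All)
    fix i assume "i \<in> {..<length b}"
    then have [measurable]: "b ! i \<in> sets borel"
      using b cell_borel[OF \<open>k \<ge> 1\<close>] by auto
    show "{x \<in> space path_space. x (- int (length b) + int i) \<in> b ! i} \<in> sets path_space"
      by measurable
  qed simp
  ultimately show ?thesis by simp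
qed

lemma block_event_shift_iff:
  assumes "x \<in> block_event k b"
  shows "path_shift (- int t) x \<in> block_event k b \<longleftrightarrow> matches x k (length b) t"
proof -
  have "block (path_shift (- int t) x) (- int (length b)) (-1) = block x (- int (length b) - int t) (- 1 - int t)"
    unfolding block_def path_shift_def by (rule nth_equalityI) (auto simp: nth_upto algebra_simps)
  then have "path_shift (- int t) x \<in> block_event k b \<longleftrightarrow>
      map (quantizer \<P> k) (block x (- int (length b) - int t) (- 1 - int t)) = map (quantizer \<P> k) (block x (- int (length b)) (-1))"
    using assms by (simp add: block_event_def)
  then show ?thesis unfolding matches_def map_block_eq_iff .
qed

lemma countable_blocks: "k \<ge> 1 \<Longrightarrow> countable (lists (\<P> k))"
  by (intro countable_lists countable_finite finite_cells)

text \<open>For each block length and each of the countably many words \<open>b\<close>, Poincare's theorem applied backwards in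
  time shows that a trajectory ending with \<open>b\<close> almost surely shows \<open>b\<close> before; only one null set per
  word has to be discarded.\<close>

lemma AE_recurrent: "AE \<omega> in M. recurrent (trajectory \<omega>)"
proof -
  interpret \<mu>: stationary_path_measure "distr M path_space trajectory" by (rule stationary_path_measure)
  have "AE x in distr M path_space trajectory. \<exists>t>0. matches x (Suc k) l t" for k l
  proof -
    have "AE x in distr M path_space trajectory. \<forall>b\<in>lists (\<P> (Suc k)).
        x \<in> block_event (Suc k) b \<longrightarrow> (\<exists>t>0. path_shift (-1 * int t) x \<in> block_event (Suc k) b)"
      unfolding AE_ball_countable[OF countable_blocks[of "Suc k", simplified]]
      by (intro ballI \<mu>.poincare_recurrence block_event_meas) auto
    then show ?thesis
    proof eventually_elim
      case (elim x)
      let ?b = "map (quantizer \<P> (Suc k)) (block x (- int l) (-1))"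
      have "length ?b = l" by (simp add: block_def)
      then have x: "x \<in> block_event (Suc k) ?b" by (simp add: block_event_def)
      have "?b \<in> lists (\<P> (Suc k))" using quantizer_cell[of "Suc k"] by auto
      from bspec[OF elim this] x obtain t where "t > 0" "path_shift (-1 * int t) x \<in> block_event (Suc k) ?b"
        by blast
      then show ?case using block_event_shift_iff[OF x, of t] \<open>length ?b = l\<close> by auto
    qed
  qed
  then have "AE x in distr M path_space trajectory. \<forall>k l. \<exists>t>0. matches x (Suc k) l t"
    unfolding AE_all_countable by blast
  then have "AE \<omega> in M. \<forall>k l. \<exists>t>0. matches (trajectory \<omega>) (Suc k) l t"
    by (rule AE_distrD[OF measurable_trajectory])
  then show ?thesis
    unfolding recurrent_def .
qed

section \<open>The filtration of quantized pasts\<close>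

text \<open>Equality of the blocks $G_{n+1}(X_{-\lambda_n}^{-1})$ at two sample points. The length $\lambda_n$ is taken at
  \<open>\<omega>\<close>; by \<open>same_code_match_len\<close> it is the same at \<open>\<omega>'\<close>, so that the relation is symmetric.\<close>

definition same_code :: "nat \<Rightarrow> 'a \<Rightarrow> 'a \<Rightarrow> bool" where
  "same_code n \<omega> \<omega>' \<longleftrightarrow> recurrent (trajectory \<omega>) \<and> recurrent (trajectory \<omega>') \<and>
     agree (Suc n) (match_len \<P> (trajectory \<omega>) n) (trajectory \<omega>) (trajectory \<omega>')"

lemma same_code_match_len:
  assumes "same_code n \<omega> \<omega>'" "i \<le> n"
  shows "match_len \<P> (trajectory \<omega>') i = match_len \<P> (trajectory \<omega>) i"
proof (rule match_len_agree[where k="Suc n"])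
  show "match_len \<P> (trajectory \<omega>) i \<le> match_len \<P> (trajectory \<omega>) n"
    using \<open>i \<le> n\<close> by (induction n rule: dec_induct) auto
qed (use assms in \<open>auto simp: same_code_def\<close>)

lemma same_code_antimono:
  assumes "same_code (Suc n) \<omega> \<omega>'" shows "same_code n \<omega> \<omega>'"
  using assms unfolding same_code_def by (auto intro: agree_coarsen)

text \<open>This is $\mathcal H_n$: past events that depend on the quantized block only. The relation
  \<open>same_code\<close> does not concern sample points without recurrence, so every past event
  without recurrent sample points is included; this saves completing the \<open>\<sigma>\<close>-algebras.\<close>

definition code_algebra :: "nat \<Rightarrow> 'a measure" where
  "code_algebra n = sigma (space M) {A \<in> sets past.
     \<forall>\<omega>\<in>space M. \<forall>\<omega>'\<in>space M. same_code n \<omega> \<omega>' \<longrightarrow> (\<omega> \<in> A \<longleftrightarrow> \<omega>' \<in> A)}"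

lemma space_code_algebra [simp]: "space (code_algebra n) = space M"
  by (simp add: code_algebra_def space_measure_of_conv)

lemma sets_code_algebra:
  "A \<in> sets (code_algebra n) \<longleftrightarrow> A \<in> sets past \<and>
     (\<forall>\<omega>\<in>space M. \<forall>\<omega>'\<in>space M. same_code n \<omega> \<omega>' \<longrightarrow> (\<omega> \<in> A \<longleftrightarrow> \<omega>' \<in> A))"
proof -
  have "sigma_algebra (space M) {A \<in> sets past.
     \<forall>\<omega>\<in>space M. \<forall>\<omega>'\<in>space M. same_code n \<omega> \<omega>' \<longrightarrow> (\<omega> \<in> A \<longleftrightarrow> \<omega>' \<in> A)}" (is "sigma_algebra _ ?\<A>")
    unfolding sigma_algebra_iff2
  proof (intro conjI ballI allI impI)
    show "?\<A> \<subseteq> Pow (space M)" using sets.sets_into_space[of _ past] by auto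
    show "{} \<in> ?\<A>" by simp
    show "space M - A \<in> ?\<A>" if "A \<in> ?\<A>" for A
      using that sets.compl_sets[of A past] by auto
    show "(\<Union>i. A i) \<in> ?\<A>" if "range A \<subseteq> ?\<A>" for A :: "nat \<Rightarrow> 'a set"
    proof -
      have A: "A i \<in> ?\<A>" for i using that by blast
      then have "(\<Union>i. A i) \<in> sets past" by auto
      moreover have "\<omega> \<in> A i \<longleftrightarrow> \<omega>' \<in> A i" if "\<omega> \<in> space M" "\<omega>' \<in> space M" "same_code n \<omega> \<omega>'" for i \<omega> \<omega>'
        using A[of i] that by blast
      ultimately show ?thesis by simp
    qed
  qed
  from sigma_algebra.sets_measure_of_eq[OF this] show ?thesis
    by (simp add: code_algebra_def)
qed

lemma code_algebra_past: "subalgebra past (code_algebra n)"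
  by (auto simp: subalgebra_def sets_code_algebra)

sublocale filtered_prob_space M code_algebra
proof
  show "subalgebra M (code_algebra n)" for n
    using code_algebra_past[of n] subalgebra_past by (auto simp: subalgebra_def)
  show "subalgebra (code_algebra (Suc n)) (code_algebra n)" for n
    unfolding subalgebra_def using same_code_antimono by (auto simp: sets_code_algebra)
qed

text \<open>For $m < 0$ and \<open>C\<close> in some $\sigma(\mathcal P_k)$, the event $X_m \in C$ is decided by the quantized block as soon as
  $\lambda_n \ge -m$ and the partition at stage $n+1$ refines $\mathcal P_k$. Since $\lambda_n > n$, both
  hold for all large \<open>n\<close> on recurrent trajectories. These events generate the past.\<close>

lemma past_approximable: "sets past \<subseteq> approximable_events"
proof -
  interpret \<A>: sigma_algebra "space M" approximable_events
    by (rule sigma_algebra_approximable_events)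
  define N where "N = sigma (space M) approximable_events"
  have N: "sets N = approximable_events" "space N = space M"
    by (simp_all add: N_def)
  have meas: "X m \<in> borel_measurable N" if "m \<in> {..-1}" for m
  proof (rule measurable_sigma_sets)
    show "sets borel = sigma_sets (UNIV :: real set) (\<Union>k\<in>{1..}. sigma_sets UNIV (\<P> k))"
      by (rule generating[symmetric])
    fix C assume "C \<in> (\<Union>k\<in>{1..}. sigma_sets UNIV (\<P> k))"
    then obtain k where k: "k \<ge> 1" "C \<in> sigma_sets UNIV (\<P> k)" by auto
    have [measurable]: "C \<in> sets borel" by (rule sigma_cells_borel[OF k])
    have m: "m \<le> -1" using that by simp
    note [measurable] = measurable_past[OF m]
    define n where "n = max k (nat (- m))"
    define B where "B = {\<omega> \<in> space past. recurrent (trajectory \<omega>) \<and> X m \<omega> \<in> C}"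
    have "B \<in> sets (code_algebra n)"
      unfolding sets_code_algebra
    proof (intro conjI ballI impI)
      show "B \<in> sets past" unfolding B_def by measurable
      fix \<omega> \<omega>' assume \<omega>: "\<omega> \<in> space M" "\<omega>' \<in> space M" "same_code n \<omega> \<omega>'"
      have "n < match_len \<P> (trajectory \<omega>) n"
        using \<omega>(3) by (intro match_len_gt) (simp add: same_code_def)
      then have "m \<in> {- int (match_len \<P> (trajectory \<omega>) n)..-1}"
        using m by (auto simp: n_def)
      then have "quantizer \<P> (Suc n) (X m \<omega>) = quantizer \<P> (Suc n) (X m \<omega>')"
        using \<omega>(3) unfolding same_code_def agree_def by blast
      then have "quantizer \<P> k (X m \<omega>) = quantizer \<P> k (X m \<omega>')"
        by (rule quantizer_coarsen[rotated 2]) (use k(1) in \<open>auto simp: n_def\<close>)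
      then have "X m \<omega> \<in> C \<longleftrightarrow> X m \<omega>' \<in> C" by (rule sigma_cells_saturated[OF k])
      then show "\<omega> \<in> B \<longleftrightarrow> \<omega>' \<in> B"
        using \<omega> by (auto simp: B_def same_code_def)
    qed
    moreover have B_meas: "B \<in> events"
      using past_imp_event[of B] calculation by (simp add: sets_code_algebra)
    let ?A = "X m -` C \<inter> space M"
    have A_meas: "?A \<in> events" by measurable
    have "prob ((?A - B) \<union> (B - ?A)) = 0"
    proof -
      have "AE \<omega> in M. \<omega> \<notin> (?A - B) \<union> (B - ?A)"
        using AE_recurrent by eventually_elim (auto simp: B_def)
      then show ?thesis by (subst prob_eq_0) (use A_meas B_meas in auto)
    qed
    ultimately show "X m -` C \<inter> space N \<in> sets N"
      unfolding N approximable_events_def using A_meas by (auto intro!: exI[of _ n] bexI[of _ B])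
  qed (auto simp: sigma_sets_into_sp)
  have "(\<lambda>\<omega>. \<lambda>n\<in>{..-1}. X n \<omega>) \<in> N \<rightarrow>\<^sub>M PiM {..-1} (\<lambda>_. borel)"
    by (intro measurable_restrict meas)
  then have "sets past \<subseteq> sets N"
    unfolding past_algebra_def by (intro sets_image_in_sets) (simp_all add: N)
  then show ?thesis by (simp add: N)
qed

section \<open>The values at the match times\<close>

text \<open>Recurrence is part of the event because otherwise the unspecified match time could be \<open>0\<close>, and
  $X_0$ does not belong to the past.\<close>

definition match_event :: "nat \<Rightarrow> real set \<Rightarrow> 'a set" where
  "match_event n C =
    {\<omega> \<in> space M. recurrent (trajectory \<omega>) \<and> X (- int (match_time \<P> (trajectory \<omega>) (Suc n))) \<omega> \<in> C}"

lemma match_time_pos: "recurrent x \<Longrightarrow> match_time \<P> x (Suc n) > 0"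
  unfolding match_time_def by (rule recurrence_time) auto

lemma match_event_past:
  assumes [measurable]: "C \<in> sets borel" shows "match_event n C \<in> sets past"
proof -
  \<comment> \<open>The maximum keeps the index negative for every possible value of the match time.\<close>
  have [measurable]: "(\<lambda>\<omega>. X (- int (max 1 (match_time \<P> (trajectory \<omega>) (Suc n)))) \<omega>) \<in> borel_measurable past"
    by (rule measurable_compose_countable[where f="\<lambda>t \<omega>. X (- int (max 1 t)) \<omega>" and g="\<lambda>\<omega>. match_time \<P> (trajectory \<omega>) (Suc n)"])
      (auto intro: measurable_past measurable_match_time)
  have "match_event n C = {\<omega> \<in> space past. recurrent (trajectory \<omega>) \<and>
      X (- int (max 1 (match_time \<P> (trajectory \<omega>) (Suc n)))) \<omega> \<in> C}"
  proof -
    have "max 1 (match_time \<P> (trajectory \<omega>) (Suc n)) = match_time \<P> (trajectory \<omega>) (Suc n)" if "recurrent (trajectory \<omega>)" for \<omega>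
      using match_time_pos[OF that, of n] by simp
    then show ?thesis unfolding match_event_def space_past by (intro Collect_cong) metis
  qed
  also have "\<dots> \<in> sets past" by measurable
  finally show ?thesis .
qed

lemma match_event_event [measurable]: "C \<in> sets borel \<Longrightarrow> match_event n C \<in> events"
  by (intro past_imp_event match_event_past)

text \<open>The match lies inside the next block, since $\tau_{n+1} \le \lambda_{n+1}$, and that block is
  quantized finely enough to decide membership in \<open>C\<close>. Moreover $\tau_{n+1} = \lambda_{n+1} - \lambda_n$ is itself a
  function of it.\<close>

lemma match_event_code_algebra:
  assumes k: "1 \<le> k" "k \<le> Suc (Suc n)" and C: "C \<in> sigma_sets UNIV (\<P> k)"
  shows "match_event n C \<in> sets (code_algebra (Suc n))"
  unfolding sets_code_algebra
proof (intro conjI ballI impI)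
  show "match_event n C \<in> sets past"
    by (rule match_event_past) (rule sigma_cells_borel[OF k(1) C])
  fix \<omega> \<omega>' assume \<omega>: "\<omega> \<in> space M" "\<omega>' \<in> space M" "same_code (Suc n) \<omega> \<omega>'"
  have len: "match_len \<P> (trajectory \<omega>') n = match_len \<P> (trajectory \<omega>) n"
    "match_len \<P> (trajectory \<omega>') (Suc n) = match_len \<P> (trajectory \<omega>) (Suc n)"
    by (rule same_code_match_len[OF \<omega>(3)]; simp)+
  have time: "match_time \<P> x (Suc n) = match_len \<P> x (Suc n) - match_len \<P> x n" for x
    by (simp add: match_time_def)
  let ?t = "match_time \<P> (trajectory \<omega>) (Suc n)"
  have t: "match_time \<P> (trajectory \<omega>') (Suc n) = ?t" unfolding time len ..
  have "?t > 0" using \<omega>(3) by (intro match_time_pos) (simp add: same_code_def)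
  then have "- int ?t \<in> {- int (match_len \<P> (trajectory \<omega>) (Suc n))..-1}" by (auto simp: time)
  then have "quantizer \<P> (Suc (Suc n)) (X (- int ?t) \<omega>) = quantizer \<P> (Suc (Suc n)) (X (- int ?t) \<omega>')"
    using \<omega>(3) unfolding same_code_def agree_def by blast
  then have "quantizer \<P> k (X (- int ?t) \<omega>) = quantizer \<P> k (X (- int ?t) \<omega>')"
    by (rule quantizer_coarsen[rotated 2]) (use k in auto)
  then have "X (- int ?t) \<omega> \<in> C \<longleftrightarrow> X (- int ?t) \<omega>' \<in> C"
    by (rule sigma_cells_saturated[OF k(1) C])
  then show "\<omega> \<in> match_event n C \<longleftrightarrow> \<omega>' \<in> match_event n C"
    using \<omega> t by (auto simp: match_event_def same_code_def)
qed

text \<open>The key identity. Split \<open>B\<close> according to the word \<open>b\<close> that the block spells. If the block of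
  some point of \<open>B\<close> spells \<open>b\<close>, then so does the block of every recurrent sample point whose last
  \<open>length b\<close> values have the word \<open>b\<close>, because $\lambda_n$ is determined by the block, and all these points
  lie in \<open>B\<close>. On this piece the match time is the time elapsed since the previous
  visit to this block event, and the previous-visit map preserves probability.\<close>

lemma prob_code_match_event:
  assumes B: "B \<in> sets (code_algebra n)" and C [measurable]: "C \<in> sets borel"
  shows "prob (B \<inter> match_event n C) = prob (B \<inter> {\<omega> \<in> space M. X 0 \<omega> \<in> C})"
proof -
  interpret \<mu>: stationary_path_measure "distr M path_space trajectory" by (rule stationary_path_measure)
  let ?L = "lists (\<P> (Suc n))"
  let ?Y = "{\<omega> \<in> space M. X 0 \<omega> \<in> C}"
  \<comment> \<open>The sample points whose block at this stage spells the given word.\<close>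
  define G where "G b = {\<omega> \<in> space M. recurrent (trajectory \<omega>) \<and> match_len \<P> (trajectory \<omega>) n = length b \<and>
    trajectory \<omega> \<in> block_event (Suc n) b}" for b
  have B_meas [measurable]: "B \<in> events"
    using B by (simp add: sets_code_algebra past_imp_event)
  have rec_meas: "Measurable.pred M (\<lambda>\<omega>. recurrent (trajectory \<omega>))"
    and len_meas: "(\<lambda>\<omega>. match_len \<P> (trajectory \<omega>) n) \<in> M \<rightarrow>\<^sub>M count_space UNIV"
    by (rule measurable_from_subalg[OF subalgebra_past]; measurable)+
  have G_meas [measurable]: "G b \<in> events" if "b \<in> ?L" for b
  proof -
    have [measurable]: "block_event (Suc n) b \<in> sets path_space" using that by (intro block_event_meas) auto
    note [measurable] = rec_meas len_meas
    show ?thesis unfolding G_def by measurable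
  qed
  have "disjoint_family_on (\<lambda>b. B \<inter> G b \<inter> U) ?L" for U
    unfolding disjoint_family_on_def
  proof (intro ballI impI)
    fix b b' :: "real set list" assume "b \<noteq> b'"
    have False if "\<omega> \<in> G b" "\<omega> \<in> G b'" for \<omega>
      using that \<open>b \<noteq> b'\<close> unfolding G_def block_event_def by auto
    then show "B \<inter> G b \<inter> U \<inter> (B \<inter> G b' \<inter> U) = {}" by blast
  qed
  then have decomp: "emeasure M (B \<inter> U) = (\<integral>\<^sup>+b. emeasure M (B \<inter> G b \<inter> U) \<partial>count_space ?L)"
    if [measurable]: "U \<in> events" for U
  proof -
    have piece: "B \<inter> G b \<inter> U \<in> events" if "b \<in> ?L" for b
      using G_meas[OF that] by simp
    have "emeasure M (B \<inter> U) = emeasure M (\<Union>b\<in>?L. B \<inter> G b \<inter> U)"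
    proof (rule emeasure_eq_AE)
      show "AE \<omega> in M. (\<omega> \<in> B \<inter> U) = (\<omega> \<in> (\<Union>b\<in>?L. B \<inter> G b \<inter> U))"
        using AE_recurrent AE_space
      proof eventually_elim
        case (elim \<omega>)
        let ?b = "map (quantizer \<P> (Suc n)) (block (trajectory \<omega>) (- int (match_len \<P> (trajectory \<omega>) n)) (-1))"
        have "length ?b = match_len \<P> (trajectory \<omega>) n" by (simp add: block_def)
        then have "\<omega> \<in> G ?b" using elim by (simp add: G_def block_event_def)
        moreover have "?b \<in> ?L" using quantizer_cell[of "Suc n"] by auto
        ultimately show ?case by blast
      qed
      show "(\<Union>b\<in>?L. B \<inter> G b \<inter> U) \<in> events"
        by (intro sets.countable_UN' countable_blocks image_subsetI piece) simp_all
    qed auto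
    also have "\<dots> = (\<integral>\<^sup>+b. emeasure M (B \<inter> G b \<inter> U) \<partial>count_space ?L)"
      by (intro emeasure_UN_countable countable_blocks piece) (simp_all add: \<open>disjoint_family_on (\<lambda>b. B \<inter> G b \<inter> U) ?L\<close>)
    finally show ?thesis .
  qed
  have cell: "emeasure M (B \<inter> G b \<inter> match_event n C) = emeasure M (B \<inter> G b \<inter> ?Y)" if b: "b \<in> ?L" for b
  proof (cases "B \<inter> G b = {}")
    case False
    then obtain \<omega>0 where \<omega>0: "\<omega>0 \<in> B" "\<omega>0 \<in> G b" by blast
    \<comment> \<open>One point of the piece already determines it: every recurrent trajectory that ends with
      this word has the same match length and belongs to B.\<close>
    have code: "\<omega> \<in> B \<and> match_len \<P> (trajectory \<omega>) n = length b"
      if \<omega>: "\<omega> \<in> space M" "recurrent (trajectory \<omega>)" "trajectory \<omega> \<in> block_event (Suc n) b" for \<omega>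
    proof -
      have "map (quantizer \<P> (Suc n)) (block (trajectory \<omega>0) (- int (length b)) (-1)) = b"
        "map (quantizer \<P> (Suc n)) (block (trajectory \<omega>) (- int (length b)) (-1)) = b"
        using \<omega>0(2) \<omega>(3) by (simp_all add: G_def block_event_def)
      then have "map (\<lambda>m. quantizer \<P> (Suc n) (X m \<omega>0)) [- int (length b)..-1]
          = map (\<lambda>m. quantizer \<P> (Suc n) (X m \<omega>)) [- int (length b)..-1]"
        by (simp add: block_def comp_def)
      then have "agree (Suc n) (length b) (trajectory \<omega>0) (trajectory \<omega>)"
        unfolding map_eq_conv set_upto agree_def .
      then have "same_code n \<omega>0 \<omega>"
        using \<omega>0(2) \<omega> by (simp add: same_code_def G_def)
      then show ?thesis
        using same_code_match_len[of n \<omega>0 \<omega> n] B \<omega>0 \<omega>(1) by (auto simp: sets_code_algebra G_def)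
    qed
    define E where "E = block_event (Suc n) b"
    define V where "V = {x :: int \<Rightarrow> real. x 0 \<in> C}"
    have [measurable]: "E \<in> sets path_space" unfolding E_def using b by (intro block_event_meas) auto
    have V [measurable]: "V \<in> sets path_space"
    proof -
      have "V = {x \<in> space path_space. x 0 \<in> C}" by (auto simp: V_def)
      also have "\<dots> \<in> sets path_space" by measurable
      finally show ?thesis .
    qed
    define ret where "ret x = (LEAST t. t > 0 \<and> path_shift (- int t) x \<in> E)" for x
    have ret_meas [measurable]: "ret \<in> path_space \<rightarrow>\<^sub>M count_space UNIV"
      unfolding ret_def by measurable
    have [measurable]: "(\<lambda>x. path_shift (- int (ret x)) x) \<in> path_space \<rightarrow>\<^sub>M path_space"
      by (rule measurable_compose_countable[where f="\<lambda>t x. path_shift (- int t) x" and g=ret]) measurable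
    define R where "R = {x \<in> E. path_shift (- int (ret x)) x \<in> V}"
    have R_meas [measurable]: "R \<in> sets path_space"
    proof -
      have "R = {x \<in> space path_space. x \<in> E \<and> path_shift (- int (ret x)) x \<in> V}" by (auto simp: R_def)
      also have "\<dots> \<in> sets path_space" by measurable
      finally show ?thesis .
    qed
    have ret_eq: "match_time \<P> (trajectory \<omega>) (Suc n) = ret (trajectory \<omega>)"
      if "trajectory \<omega> \<in> E" "match_len \<P> (trajectory \<omega>) n = length b" for \<omega>
      using that block_event_shift_iff[of "trajectory \<omega>" "Suc n" b]
      by (simp add: match_time_def recurrence_time_alt ret_def E_def)
    have "emeasure M (B \<inter> G b \<inter> match_event n C) = emeasure M (trajectory -` R \<inter> space M)"
    proof (rule emeasure_eq_AE)
      show "AE \<omega> in M. (\<omega> \<in> B \<inter> G b \<inter> match_event n C) = (\<omega> \<in> trajectory -` R \<inter> space M)"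
        using AE_recurrent AE_space
      proof eventually_elim
        case (elim \<omega>)
        show ?case
        proof (cases "trajectory \<omega> \<in> E")
          case True
          then have "\<omega> \<in> B" "\<omega> \<in> G b" "match_time \<P> (trajectory \<omega>) (Suc n) = ret (trajectory \<omega>)"
            using code[of \<omega>] elim ret_eq[of \<omega>] by (auto simp: G_def E_def)
          then show ?thesis using elim True by (simp add: match_event_def R_def V_def path_shift_def)
        next
          case False
          then show ?thesis by (simp add: R_def G_def E_def)
        qed
      qed
    qed (use b in auto)
    also have "\<dots> = emeasure (distr M path_space trajectory) R"
      by (simp add: emeasure_distr)
    also have "\<dots> = emeasure (distr M path_space trajectory) (E \<inter> V)"
      using \<mu>.first_return_measure_preserving[of E V] by (simp add: \<mu>.emeasure_eq_measure R_def ret_def)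
    also have "\<dots> = emeasure M (trajectory -` (E \<inter> V) \<inter> space M)"
      by (simp add: emeasure_distr)
    also have "\<dots> = emeasure M (B \<inter> G b \<inter> ?Y)"
    proof (rule emeasure_eq_AE)
      show "AE \<omega> in M. (\<omega> \<in> trajectory -` (E \<inter> V) \<inter> space M) = (\<omega> \<in> B \<inter> G b \<inter> ?Y)"
        using AE_recurrent AE_space
      proof eventually_elim
        case (elim \<omega>)
        then show ?case using code[of \<omega>] by (auto simp: G_def E_def V_def)
      qed
    qed (use b in auto)
    finally show ?thesis .
  qed simp
  have "emeasure M (B \<inter> match_event n C) = emeasure M (B \<inter> ?Y)"
    unfolding decomp[OF match_event_event[OF C]] decomp[of ?Y, simplified]
    by (intro nn_integral_cong) (simp add: cell)
  then show ?thesis by (simp add: measure_def)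
qed

lemma cond_exp_match_event:
  assumes C [measurable]: "C \<in> sets borel"
  shows "AE \<omega> in M. real_cond_exp M (code_algebra n) (indicator (match_event n C)) \<omega>
    = real_cond_exp M (code_algebra n) (\<lambda>\<omega>. indicator C (X 0 \<omega>)) \<omega>"
proof -
  interpret H: sigma_finite_subalgebra M "code_algebra n" by (rule sigma_finite_subalg)
  have int_hit: "integrable M (indicator (match_event n C) :: 'a \<Rightarrow> real)"
    by (intro integrable_real_indicator) (auto simp: emeasure_eq_measure)
  have int_now: "integrable M (\<lambda>\<omega>. indicator C (X 0 \<omega>) :: real)"
    by (rule integrable_const_bound[where B=1]) auto
  show ?thesis
  proof (rule H.real_cond_exp_charact[OF _ int_hit])
    fix B assume B: "B \<in> sets (code_algebra n)"
    then have [measurable]: "B \<in> events" by (simp add: sets_code_algebra past_imp_event)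
    have "(LINT \<omega>:B|M. indicator (match_event n C) \<omega> :: real) = expectation (indicator (B \<inter> match_event n C))"
      unfolding set_lebesgue_integral_def
      by (intro Bochner_Integration.integral_cong) (auto simp: indicator_def)
    also have "\<dots> = prob (B \<inter> match_event n C)" by simp
    also have "\<dots> = prob (B \<inter> {\<omega> \<in> space M. X 0 \<omega> \<in> C})" by (rule prob_code_match_event[OF B C])
    also have "\<dots> = expectation (indicator (B \<inter> {\<omega> \<in> space M. X 0 \<omega> \<in> C}))" by simp
    also have "\<dots> = (LINT \<omega>:B|M. indicator C (X 0 \<omega>))"
      unfolding set_lebesgue_integral_def
      by (intro Bochner_Integration.integral_cong) (auto simp: indicator_def)
    also have "\<dots> = (LINT \<omega>:B|M. real_cond_exp M (code_algebra n) (\<lambda>\<omega>. indicator C (X 0 \<omega>)) \<omega>)"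
      by (rule H.real_cond_exp_intA[OF int_now B])
    finally show "(LINT \<omega>:B|M. indicator (match_event n C) \<omega>)
      = (LINT \<omega>:B|M. real_cond_exp M (code_algebra n) (\<lambda>\<omega>. indicator C (X 0 \<omega>)) \<omega>)" .
  qed (auto intro: H.real_cond_exp_int(1)[OF int_now])
qed

text \<open>The frequencies are Cesaro means of $1_C(X_{-\tau_{n+1}}) = d_n + p_n$, where $p_n$ is a convergent
  martingale and $d_n$ are orthogonal.\<close>

lemma match_frequency_tendsto:
  assumes k: "k \<ge> 1" and C: "C \<in> sigma_sets UNIV (\<P> k)"
  shows "AE \<omega> in M. (\<lambda>n. (\<Sum>i<n. indicator (match_event i C) \<omega>) / real n)
    \<longlonglongrightarrow> real_cond_exp M past (\<lambda>\<omega>. indicator C (X 0 \<omega>)) \<omega>"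
proof -
  have C_borel [measurable]: "C \<in> sets borel" by (rule sigma_cells_borel[OF k C])
  define p where "p n = real_cond_exp M (code_algebra n) (\<lambda>\<omega>. indicator C (X 0 \<omega>))" for n
  \<comment> \<open>Before stage k the partitions may be too coarse for C, and the differences need not be
    orthogonal; dropping finitely many of them does not change the limit of the averages.\<close>
  define d where "d n \<omega> = (if n < k then 0 else indicator (match_event n C) \<omega> - p n \<omega>)" for n \<omega>
  have int_now: "integrable M (\<lambda>\<omega>. indicator C (X 0 \<omega>) :: real)"
    by (rule integrable_const_bound[where B=1]) auto
  have p_meas_code [measurable]: "p n \<in> borel_measurable (code_algebra n)" for n
    unfolding p_def by simp
  have p_meas [measurable]: "p n \<in> borel_measurable M" for n
    by (rule measurable_from_subalg[OF subalg p_meas_code])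
  have p_bound: "AE \<omega> in M. 0 \<le> p n \<omega> \<and> p n \<omega> \<le> 1" for n
  proof -
    interpret H: sigma_finite_subalgebra M "code_algebra n" by (rule sigma_finite_subalg)
    have "AE \<omega> in M. p n \<omega> \<ge> 0" "AE \<omega> in M. p n \<omega> \<le> 1"
      unfolding p_def
      by (rule H.real_cond_exp_ge_c[OF int_now] H.real_cond_exp_le_c[OF int_now]; simp)+
    then show ?thesis by eventually_elim simp
  qed
  have d_meas [measurable]: "d n \<in> borel_measurable M" for n
    unfolding d_def by measurable
  have d_bound: "AE \<omega> in M. \<bar>d n \<omega>\<bar> \<le> 1" for n
    using p_bound[of n] by eventually_elim (auto simp: d_def indicator_def)
  have d_code: "d i \<in> borel_measurable (code_algebra j)" if "i < j" for i j
  proof -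
    have "d i \<in> borel_measurable (code_algebra (Suc i))"
    proof (cases "i < k")
      case True
      then have "d i = (\<lambda>\<omega>. 0)" by (simp add: d_def fun_eq_iff)
      then show ?thesis by simp
    next
      case False
      then have [measurable]: "match_event i C \<in> sets (code_algebra (Suc i))"
        by (intro match_event_code_algebra[OF k _ C]) simp
      have [measurable]: "p i \<in> borel_measurable (code_algebra (Suc i))"
        by (rule measurable_from_subalg[OF subalg_Suc p_meas_code])
      from False have "d i = (\<lambda>\<omega>. indicator (match_event i C) \<omega> - p i \<omega>)" by (simp add: d_def fun_eq_iff)
      then show ?thesis by simp
    qed
    then show ?thesis
      by (rule measurable_from_subalg[OF subalg_mono, rotated]) (use that in simp)
  qed
  have orth: "expectation (\<lambda>\<omega>. d i \<omega> * d j \<omega>) = 0" if "i < j" for i j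
  proof (cases "j < k")
    case False
    interpret H: sigma_finite_subalgebra M "code_algebra j" by (rule sigma_finite_subalg)
    have int_hit: "integrable M (\<lambda>\<omega>. d i \<omega> * indicator (match_event j C) \<omega>)"
      by (rule integrable_const_bound[where B=1])
        (rule eventually_mono[OF d_bound[of i]], auto simp: indicator_def)
    have "AE \<omega> in M. norm (d i \<omega> * p j \<omega>) \<le> 1"
      using d_bound[of i] p_bound[of j] by eventually_elim (simp add: abs_mult mult_le_one)
    then have int_p: "integrable M (\<lambda>\<omega>. d i \<omega> * p j \<omega>)"
      by (intro integrable_const_bound[where B=1]) auto
    have "expectation (\<lambda>\<omega>. d i \<omega> * indicator (match_event j C) \<omega>)
        = expectation (\<lambda>\<omega>. d i \<omega> * real_cond_exp M (code_algebra j) (indicator (match_event j C)) \<omega>)"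
      by (rule H.real_cond_exp_intg(2)[OF int_hit, symmetric]) (use d_code[OF that] in auto)
    also have "\<dots> = expectation (\<lambda>\<omega>. d i \<omega> * p j \<omega>)"
    proof (rule integral_cong_AE)
      show "AE \<omega> in M. d i \<omega> * real_cond_exp M (code_algebra j) (indicator (match_event j C)) \<omega> = d i \<omega> * p j \<omega>"
        using cond_exp_match_event[OF C_borel, of j] by eventually_elim (simp add: p_def)
    qed measurable
    finally have "expectation (\<lambda>\<omega>. d i \<omega> * indicator (match_event j C) \<omega>) - expectation (\<lambda>\<omega>. d i \<omega> * p j \<omega>) = 0"
      by simp
    then show ?thesis
      using False Bochner_Integration.integral_diff[OF int_hit int_p] by (simp add: d_def right_diff_distrib)
  qed (simp add: d_def)
  have "AE \<omega> in M. (\<lambda>n. (\<Sum>i<n. d i \<omega>) / real n) \<longlonglongrightarrow> 0"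
    by (rule averages_of_orthogonal_bounded_tendsto_0[OF d_meas d_bound orth])
  moreover have "AE \<omega> in M. (\<lambda>n. p n \<omega>) \<longlonglongrightarrow> real_cond_exp M past (\<lambda>\<omega>. indicator C (X 0 \<omega>)) \<omega>"
    unfolding p_def
    by (rule levy_upward[OF subalgebra_past past_approximable code_algebra_past int_now])
  ultimately show ?thesis
  proof eventually_elim
    case (elim \<omega>)
    let ?L = "real_cond_exp M past (\<lambda>\<omega>. indicator C (X 0 \<omega>)) \<omega>"
    have "\<forall>\<^sub>F n in sequentially. p n \<omega> = indicator (match_event n C) \<omega> - d n \<omega>"
      using eventually_ge_at_top[of k] by eventually_elim (simp add: d_def)
    with elim(2) have "(\<lambda>n. indicator (match_event n C) \<omega> - d n \<omega>) \<longlonglongrightarrow> ?L"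
      by (rule Lim_transform_eventually)
    from tendsto_add[OF cesaro_mean_tendsto[OF this] elim(1)] show ?case
      by (simp add: sum_subtractf diff_divide_distrib)
  qed
qed

lemma measure_estimator_tendsto:
  assumes k: "k \<ge> 1" and C: "C \<in> sigma_sets UNIV (\<P> k)" and K: "regular_cond_distr M past (X 0) K"
  shows "AE \<omega> in M. (\<lambda>n. measure (estimator \<P> (trajectory \<omega>) n) C) \<longlonglongrightarrow> measure (K \<omega>) C"
proof -
  have C_borel: "C \<in> sets borel" by (rule sigma_cells_borel[OF k C])
  have "AE \<omega> in M. measure (K \<omega>) C = real_cond_exp M past (\<lambda>\<omega>'. indicator C (X 0 \<omega>')) \<omega>"
    using K C_borel unfolding regular_cond_distr_def by blast
  with match_frequency_tendsto[OF k C] AE_recurrent AE_space show ?thesis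
  proof eventually_elim
    case (elim \<omega>)
    have "measure (estimator \<P> (trajectory \<omega>) n) C = (\<Sum>i<n. indicator (match_event i C) \<omega>) / real n" for n
    proof -
      have "(\<Sum>j = 1..n. indicator C (X (- int (match_time \<P> (trajectory \<omega>) j)) \<omega>) :: real)
          = (\<Sum>i<n. indicator (match_event i C) \<omega>)"
        unfolding One_nat_def sum.atLeast1_atMost_eq
        by (intro sum.cong) (use elim(2,3) in \<open>auto simp: match_event_def indicator_def\<close>)
      then show ?thesis by (simp add: measure_estimator[OF C_borel])
    qed
    with elim(1,4) show ?case by simp
  qed
qed

end

section \<open>Weak convergence\<close>

text \<open>A point of continuity of the limit is enclosed by two nearby points at which convergence is known;
  distribution functions are monotone. Only the tail of the sequence has to consist of probability
  distributions, since the estimator from \<open>0\<close> matches is the null measure.\<close>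

lemma weak_conv_m_if_cdf_tendsto_densely:
  assumes N: "\<forall>\<^sub>F n in sequentially. real_distribution (N n)" and L: "real_distribution L"
    and dense: "\<And>x y :: real. x < y \<Longrightarrow> \<exists>b. x \<le> b \<and> b < y \<and> (\<lambda>n. cdf (N n) b) \<longlonglongrightarrow> cdf L b"
  shows "weak_conv_m N L"
  unfolding weak_conv_m_def weak_conv_def
proof (intro allI impI)
  interpret L: real_distribution L by (rule L)
  fix x assume "isCont (cdf L) x"
  show "(\<lambda>n. cdf (N n) x) \<longlonglongrightarrow> cdf L x"
  proof (rule tendstoI)
    fix e :: real assume "e > 0"
    then have "e / 2 > 0" by simp
    then obtain s where s: "s > 0" "\<And>y. \<bar>y - x\<bar> < s \<Longrightarrow> \<bar>cdf L y - cdf L x\<bar> < e / 2"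
      using \<open>isCont (cdf L) x\<close> unfolding continuous_at_eps_delta dist_real_def by blast
    obtain a where a: "x - s / 2 \<le> a" "a < x" "(\<lambda>n. cdf (N n) a) \<longlonglongrightarrow> cdf L a"
      using dense[of "x - s / 2" x] s(1) by auto
    obtain b where b: "x \<le> b" "b < x + s / 2" "(\<lambda>n. cdf (N n) b) \<longlonglongrightarrow> cdf L b"
      using dense[of x "x + s / 2"] s(1) by auto
    have close: "\<bar>cdf L a - cdf L x\<bar> < e / 2" "\<bar>cdf L b - cdf L x\<bar> < e / 2"
      using s(2)[of a] s(2)[of b] a(1,2) b(1,2) s(1) by (simp_all add: abs_less_iff)
    from N tendstoD[OF a(3) \<open>e / 2 > 0\<close>] tendstoD[OF b(3) \<open>e / 2 > 0\<close>]
    show "\<forall>\<^sub>F n in sequentially. dist (cdf (N n) x) (cdf L x) < e"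
    proof eventually_elim
      case (elim n)
      interpret N: real_distribution "N n" by (rule elim(1))
      have "cdf (N n) a \<le> cdf (N n) x" "cdf (N n) x \<le> cdf (N n) b"
        using a(2) b(1) by (auto intro!: N.cdf_nondecreasing)
      with elim(2,3) close show ?case unfolding dist_real_def by linarith
    qed
  qed
qed

lemma weak_conv_m_compose:
  "weak_conv_m N L \<Longrightarrow> filterlim f at_top sequentially \<Longrightarrow> weak_conv_m (\<lambda>t. N (f t)) L"
  unfolding weak_conv_m_def weak_conv_def by (auto intro: filterlim_compose)

text \<open>Each set comes with its own exceptional null set, so convergence is needed for a countable family
  that is still rich enough for weak convergence: the finite unions of cells.\<close>

lemma (in recurrence_forecasting) weak_conv_estimator:
  assumes K: "regular_cond_distr M past (X 0) K"
  shows "AE \<omega> in M. weak_conv_m (estimator \<P> (trajectory \<omega>)) (K \<omega>)"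
proof -
  define \<C> where "\<C> = (\<Union>k\<in>{1..}. Union ` Pow (\<P> k))"
  have "countable \<C>"
    unfolding \<C>_def
    by (rule countable_UN) (auto intro!: countable_finite finite_cells)
  have "AE \<omega> in M. \<forall>C\<in>\<C>. (\<lambda>n. measure (estimator \<P> (trajectory \<omega>) n) C) \<longlonglongrightarrow> measure (K \<omega>) C"
    unfolding AE_ball_countable[OF \<open>countable \<C>\<close>]
  proof
    fix C assume "C \<in> \<C>"
    then obtain k Q where k: "k \<ge> 1" and Q: "Q \<subseteq> \<P> k" "C = \<Union>Q" by (auto simp: \<C>_def)
    have "countable Q" using finite_subset[OF Q(1) finite_cells[OF k]] by (rule countable_finite)
    then have "C \<in> sigma_sets UNIV (\<P> k)"
      unfolding Q(2) by (rule sigma_sets_UNION) (use Q(1) in \<open>blast intro: sigma_sets.Basic\<close>)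
    then show "AE \<omega> in M. (\<lambda>n. measure (estimator \<P> (trajectory \<omega>) n) C) \<longlonglongrightarrow> measure (K \<omega>) C"
      by (rule measure_estimator_tendsto[OF k _ K])
  qed
  with AE_space show ?thesis
  proof eventually_elim
    case (elim \<omega>)
    have "K \<omega> \<in> space (prob_algebra borel)"
      using K elim(1) measurable_space[of K past "prob_algebra borel" \<omega>]
      unfolding regular_cond_distr_def space_past by blast
    then have "real_distribution (K \<omega>)"
      by (simp add: space_prob_algebra real_distribution_def real_distribution_axioms_def)
    moreover have "\<forall>\<^sub>F n in sequentially. real_distribution (estimator \<P> (trajectory \<omega>) n)"
      using eventually_ge_at_top[of 1] by eventually_elim (rule real_distribution_estimator)
    moreover have "\<exists>b. x \<le> b \<and> b < y \<and> (\<lambda>n. cdf (estimator \<P> (trajectory \<omega>) n) b) \<longlonglongrightarrow> cdf (K \<omega>) b"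
      if "x < y" for x y
    proof -
      obtain k Q b where b: "k \<ge> 1" "Q \<subseteq> \<P> k" "\<Union>Q = {..b}" "x \<le> b" "b < y"
        using half_lines_dense[OF \<open>x < y\<close>] by blast
      then have "\<Union>Q \<in> \<C>" unfolding \<C>_def by blast
      from bspec[OF elim(2) this] have "(\<lambda>n. cdf (estimator \<P> (trajectory \<omega>) n) b) \<longlonglongrightarrow> cdf (K \<omega>) b"
        unfolding b(3) cdf_def .
      with b(4,5) show ?thesis by blast
    qed
    ultimately show ?case by (intro weak_conv_m_if_cdf_tendsto_densely)
  qed
qed

theorem theorem1:
  fixes M :: "'a measure" and X :: "int \<Rightarrow> 'a \<Rightarrow> real"
    and \<P> :: "nat \<Rightarrow> real set set" and K :: "'a \<Rightarrow> real measure"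
  assumes "prob_space M"
    and "\<And>n. X n \<in> borel_measurable M"
    and "stationary_process M X"
    and "ergodic_process M X"
    and "admissible_partitions \<P>"
    and "regular_cond_distr M (past_algebra M X) (X 0) K"
  shows "(AE \<omega> in M. weak_conv_m (\<lambda>k. estimator \<P> (\<lambda>n. X n \<omega>) k) (K \<omega>)) \<and>
         (AE \<omega> in M. weak_conv_m (\<lambda>t. past_estimator \<P> (\<lambda>n. X n \<omega>) t) (K \<omega>))"
proof -
  interpret recurrence_forecasting M \<P> X
    by (intro recurrence_forecasting.intro quantizing_partitions.intro
        recurrence_forecasting_axioms.intro assms)
  have conv: "AE \<omega> in M. weak_conv_m (estimator \<P> (trajectory \<omega>)) (K \<omega>)"
    by (rule weak_conv_estimator[OF assms(6)])
  moreover have "AE \<omega> in M. weak_conv_m (past_estimator \<P> (trajectory \<omega>)) (K \<omega>)"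
    using conv AE_recurrent
  proof eventually_elim
    case (elim \<omega>)
    show ?case
      unfolding past_estimator_def
      by (rule weak_conv_m_compose[OF elim(1) match_count_at_top[OF elim(2)]])
  qed
  ultimately show ?thesis by blast
qed

end
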